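(* Let $W$ be a standard ($d_1$-dimensional) Brownian motion, and let $W^H$ be a ($d_2$-dimensional) fractional Brownian motion with Hurst parameter $H\in(\frac12,1)$. Let $p\in(2,3)$ be such that $\frac1p+H>1$, and let $\mathcal{P}^n=\{0=t^n_0<t^n_1<\cdots<t^n_{N_n}=T\}$, $n\in\mathbb{N}$, be a sequence of equidistant partitions of the interval $[0,T]$, so that, for each $n\in\mathbb{N}$, there exists some $\pi_n>0$ such that $t^n_{i+1}-t^n_i=\pi_n$ for each $0\le i<N_n$. If $\pi_n^{2-\frac4p}\log(n)\to0$ as $n\to\infty$, then, for almost every $\omega\in\Omega$, the sample path $(W(\omega),W^H(\omega))$ satisfies Property (RIE) relative to $p$ and $(\mathcal{P}^n)_{n\in\mathbb{N}}$.
   Context: $T>0$ is a fixed time horizon. $W$ and $W^H$ are independent and defined on a common filtered probability space $(\Omega,\mathcal{F},(\mathcal{F}_t)_{t\in[0,T]},\mathbb{P})$ satisfying the usual conditions. Notation. $\Delta_T=\{(s,t)\in[0,T]^2:s\le t\}$; $X_{s,t}=X_t-X_s$; $x\otimes y=(x^iy^j)_{i,j}$; $|\mathcal{P}|=\max_i|u_{i+1}-u_i|$ is the mesh size of a partition. A control function is $w\colon\Delta_T\to[0,\infty)$ with $w(s,u)+w(u,t)\le w(s,t)$ for $s\le u\le t$. Convention: $\frac00:=0$. Property (RIE). Let $p\in(2,3)$ and let $\mathcal{P}^n=\{0=t^n_0<\cdots<t^n_{N_n}=T\}$ be a sequence of partitions of $[0,T]$ with $|\mathcal{P}^n|\to0$.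 For a càdlàg path $X\colon[0,T]\to\mathbb{R}^d$ put $X^n_t=X_T\mathbf{1}_{\{T\}}(t)+\sum_{k=0}^{N_n-1}X_{t^n_k}\mathbf{1}_{[t^n_k,t^n_{k+1})}(t)$. $X$ satisfies Property (RIE) relative to $p$ and $(\mathcal{P}^n)$ if: (i) $X^n\to X$ uniformly; (ii) the Riemann sums $\int_0^tX^n_u\otimes\mathrm{d}X_u:=\sum_{k=0}^{N_n-1}X_{t^n_k}\otimes X_{t^n_k\wedge t,t^n_{k+1}\wedge t}$ converge uniformly in $t\in[0,T]$ as $n\to\infty$; (iii) there is a control function $w$ such that $$\sup_{(s,t)\in\Delta_T}\frac{|X_{s,t}|^p}{w(s,t)}+\sup_{n\in\mathbb{N}}\sup_{0\le k<\ell\le N_n}\frac{|\int_{t^n_k}^{t^n_\ell}X^n_u\otimes\mathrm{d}X_u-X_{t^n_k}\otimes X_{t^n_k,t^n_\ell}|^{p/2}}{w(t^n_k,t^n_\ell)}\le1,$$ where integrals over $[s,t]$ are differences of those over $[0,t]$ and $[0,s]$. (Here it is applied with $d=d_1+d_2$.) *)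

theory Defs
  imports "HOL-Probability.Probability"
begin

section \<open>Paths and partitions\<close>

text \<open>Paths on \<open>[0, T]\<close> are total functions on the reals of which only the values on
  \<open>{0..T}\<close> are used.\<close>

definition cadlag_on :: "real \<Rightarrow> (real \<Rightarrow> 'b::topological_space) \<Rightarrow> bool" where
  "cadlag_on T X \<longleftrightarrow>
     (\<forall>t\<in>{0..<T}. (X \<longlongrightarrow> X t) (at_right t)) \<and>
     (\<forall>t\<in>{0<..T}. \<exists>l. (X \<longlongrightarrow> l) (at_left t))"

definition is_partition :: "real \<Rightarrow> nat \<Rightarrow> (nat \<Rightarrow> real) \<Rightarrow> bool" where
  "is_partition T N u \<longleftrightarrow> u 0 = 0 \<and> u N = T \<and> (\<forall>i<N. u i < u (Suc i))"

definition mesh :: "nat \<Rightarrow> (nat \<Rightarrow> real) \<Rightarrow> real" where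
  "mesh N u = Max ((\<lambda>i. \<bar>u (Suc i) - u i\<bar>) ` {..<N})"

definition outer :: "real ^ 'm \<Rightarrow> real ^ 'n \<Rightarrow> real ^ 'n ^ 'm" where
  "outer x y = (\<chi> i j. x $ i * y $ j)"

definition time_simplex :: "real \<Rightarrow> (real \<times> real) set" where
  "time_simplex T = {(s, t). 0 \<le> s \<and> s \<le> t \<and> t \<le> T}"

definition control_function :: "real \<Rightarrow> (real \<Rightarrow> real \<Rightarrow> real) \<Rightarrow> bool" where
  "control_function T w \<longleftrightarrow>
     (\<forall>(s, t)\<in>time_simplex T. 0 \<le> w s t) \<and>
     (\<forall>s u t. 0 \<le> s \<and> s \<le> u \<and> u \<le> t \<and> t \<le> T \<longrightarrow> w s u + w u t \<le> w s t)"

section \<open>Property (RIE)\<close>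

definition step_path ::
  "real \<Rightarrow> nat \<Rightarrow> (nat \<Rightarrow> real) \<Rightarrow> (real \<Rightarrow> 'b::real_vector) \<Rightarrow> real \<Rightarrow> 'b" where
  "step_path T N u X t =
     indicator {T} t *\<^sub>R X T + (\<Sum>k<N. indicator {u k..<u (Suc k)} t *\<^sub>R X (u k))"

definition riemann_sum ::
  "nat \<Rightarrow> (nat \<Rightarrow> real) \<Rightarrow> (real \<Rightarrow> real ^ 'd) \<Rightarrow> real \<Rightarrow> real ^ 'd ^ 'd" where
  "riemann_sum N u X t =
     (\<Sum>k<N. outer (X (u k)) (X (min (u (Suc k)) t) - X (min (u k) t)))"

text \<open>The quotients are formed in \<^typ>\<open>ennreal\<close>, where \<open>0 / 0 = 0\<close> while \<open>a / 0 = \<infinity>\<close> for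
  \<open>a > 0\<close>; division in \<^typ>\<open>real\<close> would make the bound vacuous where the control vanishes.
  The norm on matrices is the Euclidean one.\<close>

definition property_RIE ::
  "real \<Rightarrow> real \<Rightarrow> (nat \<Rightarrow> nat) \<Rightarrow> (nat \<Rightarrow> nat \<Rightarrow> real) \<Rightarrow> (real \<Rightarrow> real ^ 'd) \<Rightarrow> bool" where
  "property_RIE T p N u X \<longleftrightarrow>
     2 < p \<and> p < 3 \<and>
     (\<forall>n. is_partition T (N n) (u n)) \<and>
     (\<lambda>n. mesh (N n) (u n)) \<longlonglongrightarrow> 0 \<and>
     cadlag_on T X \<and>
     uniform_limit {0..T} (\<lambda>n. step_path T (N n) (u n) X) X sequentially \<and>
     uniformly_convergent_on {0..T} (\<lambda>n. riemann_sum (N n) (u n) X) \<and>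
     (\<exists>w. control_function T w \<and>
        (SUP (s, t)\<in>time_simplex T. ennreal (norm (X t - X s) powr p) / ennreal (w s t)) +
        (SUP n. SUP (k, l)\<in>{(k, l). k < l \<and> l \<le> N n}.
           ennreal (norm (riemann_sum (N n) (u n) X (u n l) - riemann_sum (N n) (u n) X (u n k)
                          - outer (X (u n k)) (X (u n l) - X (u n k))) powr (p / 2))
           / ennreal (w (u n k) (u n l)))
        \<le> 1)"

section \<open>Stochastic processes\<close>

locale usual_filtered_prob_space = prob_space M for M :: "'a measure" +
  fixes F :: "real \<Rightarrow> 'a measure" and T :: real
  assumes subalgebra_F: "t \<in> {0..T} \<Longrightarrow> subalgebra M (F t)"
    and mono_F: "0 \<le> s \<Longrightarrow> s \<le> t \<Longrightarrow> t \<le> T \<Longrightarrow> sets (F s) \<subseteq> sets (F t)"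
    and complete_M: "complete_measure M"
    and null_sets_F: "null_sets M \<subseteq> sets (F 0)"
    and right_continuous_F: "t \<in> {0..<T} \<Longrightarrow> sets (F t) = (\<Inter>s\<in>{t<..T}. sets (F s))"

context prob_space
begin

definition brownian_motion :: "real \<Rightarrow> (real \<Rightarrow> 'a \<Rightarrow> real ^ 'd) \<Rightarrow> bool" where
  "brownian_motion T W \<longleftrightarrow>
     (\<forall>t\<in>{0..T}. random_variable borel (W t)) \<and>
     (AE \<omega> in M. W 0 \<omega> = 0) \<and>
     (\<forall>m \<tau>. (\<forall>i\<le>m. \<tau> i \<in> {0..T}) \<and> (\<forall>i<m. \<tau> i \<le> \<tau> (Suc i)) \<longrightarrow>
        indep_vars (\<lambda>_. borel) (\<lambda>i \<omega>. W (\<tau> (Suc i)) \<omega> - W (\<tau> i) \<omega>) {..<m::nat}) \<and>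
     (\<forall>s t. 0 \<le> s \<and> s < t \<and> t \<le> T \<longrightarrow>
        distributed M lborel (\<lambda>\<omega>. W t \<omega> - W s \<omega>)
          (\<lambda>x. ennreal (\<Prod>i\<in>UNIV. normal_density 0 (sqrt (t - s)) (x $ i)))) \<and>
     (AE \<omega> in M. continuous_on {0..T} (\<lambda>t. W t \<omega>))"

text \<open>Point masses count as Gaussian.\<close>

definition gaussian_rv :: "('a \<Rightarrow> real) \<Rightarrow> bool" where
  "gaussian_rv Z \<longleftrightarrow> random_variable borel Z \<and>
     (\<exists>\<mu>. (AE \<omega> in M. Z \<omega> = \<mu>) \<or>
          (\<exists>\<sigma>>0. distributed M lborel Z (\<lambda>x. ennreal (normal_density \<mu> \<sigma> x))))"

definition gaussian_process :: "real \<Rightarrow> (real \<Rightarrow> 'a \<Rightarrow> real) \<Rightarrow> bool" where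
  "gaussian_process T B \<longleftrightarrow>
     (\<forall>J c. finite J \<and> J \<subseteq> {0..T} \<longrightarrow> gaussian_rv (\<lambda>\<omega>. \<Sum>t\<in>J. c t * B t \<omega>))"

definition fractional_brownian_motion_1 :: "real \<Rightarrow> real \<Rightarrow> (real \<Rightarrow> 'a \<Rightarrow> real) \<Rightarrow> bool" where
  "fractional_brownian_motion_1 T H B \<longleftrightarrow>
     gaussian_process T B \<and>
     (\<forall>t\<in>{0..T}. expectation (B t) = 0) \<and>
     (\<forall>s\<in>{0..T}. \<forall>t\<in>{0..T}. expectation (\<lambda>\<omega>. B s \<omega> * B t \<omega>) =
        (s powr (2 * H) + t powr (2 * H) - \<bar>t - s\<bar> powr (2 * H)) / 2) \<and>
     (AE \<omega> in M. continuous_on {0..T} (\<lambda>t. B t \<omega>))"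

definition fractional_brownian_motion ::
  "real \<Rightarrow> real \<Rightarrow> (real \<Rightarrow> 'a \<Rightarrow> real ^ 'd) \<Rightarrow> bool" where
  "fractional_brownian_motion T H B \<longleftrightarrow>
     (\<forall>i. fractional_brownian_motion_1 T H (\<lambda>t \<omega>. B t \<omega> $ i)) \<and>
     indep_vars (\<lambda>_. PiM {0..T} (\<lambda>_. borel)) (\<lambda>i \<omega>. \<lambda>t\<in>{0..T}. B t \<omega> $ i) UNIV"

definition process_sigma :: "real \<Rightarrow> (real \<Rightarrow> 'a \<Rightarrow> 'b::topological_space) \<Rightarrow> 'a measure" where
  "process_sigma T Z =
     vimage_algebra (space M) (\<lambda>\<omega>. \<lambda>t\<in>{0..T}. Z t \<omega>) (PiM {0..T} (\<lambda>_. borel))"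

text \<open>\<^const>\<open>indep_var\<close> would force both processes to have the same value type.\<close>

definition indep_processes ::
  "real \<Rightarrow> (real \<Rightarrow> 'a \<Rightarrow> 'b::topological_space) \<Rightarrow> (real \<Rightarrow> 'a \<Rightarrow> 'c::topological_space) \<Rightarrow> bool"
where
  "indep_processes T Y Z \<longleftrightarrow> indep_set (sets (process_sigma T Y)) (sets (process_sigma T Z))"

end

definition join_vec :: "real ^ 'm \<Rightarrow> real ^ 'n \<Rightarrow> real ^ ('m + 'n)" where
  "join_vec x y = (\<chi> i. case i of Inl j \<Rightarrow> x $ j | Inr j \<Rightarrow> y $ j)"

end

theory Submission
  imports Defs "HOL-Real_Asymp.Real_Asymp"
begin

text \<open>
  Every equidistant partition of \<open>[0, T]\<close> is the grid with \<open>N\<close> cells of length \<open>h = T / N\<close> for some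
  \<open>N\<close>, so it suffices to control, for each pair \<open>(f, g)\<close> of coordinates of the path, the Riemann
  sums \<open>J_N\<close> of \<open>f\<close> against \<open>g\<close> on all these grids at once; along the given sequence \<open>N\<close> tends to
  infinity (\<open>mesh_tendsto_zero\<close>).  The quantity that decides everything is the effect of cutting
  each cell into \<open>q\<close> equal pieces.  Between grid points \<open>s < t\<close> it changes the Riemann sum by
  \<open>\<Sum>j. \<Sum>c<q. (f x(j,c) - f x(j,0)) * (g x(j,c+1) - g x(j,c))\<close>, where the \<open>x(j,c)\<close> are the points of
  the refined grid in cell \<open>j\<close>, and \<open>refinement_bound\<close> requires this to be at most
  \<open>K * h\<^sup>\<eta> * (t - s)\<^sup>\<beta>\<close> with \<open>\<beta> = 2 / p\<close>, some \<open>\<eta> > 0\<close> and a \<open>K\<close> that may depend on the path and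
  on \<open>q\<close>, but not on the grid or on \<open>s, t\<close>.

  This bound has deterministic consequences (locale \<open>compensated_pair\<close>).  Doubling repeatedly, the
  errors form a geometric series, so \<open>J_(N * 2^m)\<close> converges as \<open>m\<close> grows; the bound for \<open>q = N\<close>
  shows that the limit \<open>J\<close> is the same for all \<open>N\<close>.  Summing the series gives
  \<open>J_N \<longlonglongrightarrow> J\<close> uniformly (\<open>grid_sum_uniform_error\<close>).  For arbitrary \<open>s < t\<close>, comparison of \<open>J\<close> with the
  grid whose cells have length about \<open>t - s\<close>, on which only one or two cells meet \<open>[s, t]\<close>, gives
  \<open>\<bar>J t - J s - f s * (g t - g s)\<bar> \<le> C * (t - s)\<^sup>\<beta>\<close>; returning from \<open>J\<close> to \<open>J_N\<close> at grid points yields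
  the same for the Riemann sums themselves (\<open>grid_area_bound\<close>).  Together with Hoelder continuity of
  exponent above \<open>1 / p\<close> this makes \<open>w s t = c * (t - s)\<close> a suitable control
  (\<open>property_RIE_of_components\<close>).

  It remains to prove the refinement bound almost surely.  If \<open>f\<close> or \<open>g\<close> is a coordinate of the
  fractional Brownian motion, the Hoelder exponents add up to more than 1, and estimating term by
  term is enough, as for the Young integral (\<open>refinement_bound_young\<close>).  If both are coordinates of
  the Brownian motion, then the terms with \<open>c = 0\<close> vanish, while for fixed \<open>c \<ge> 1\<close> the summands with
  different \<open>j\<close> are independent, and each is the product of two independent centred Gaussians of variance at most \<open>h\<close>.  Hence a sum over
  \<open>m\<close> cells has bounded exponential moments at scale \<open>sqrt m * h\<close>
  (\<open>brownian_area_exp_moment\<close>).  Compared with that scale the desired bound \<open>h\<^sup>\<eta> * (m * h)\<^sup>\<beta>\<close> is larger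
  by a factor of at least \<open>h\<close> to the power \<open>\<eta> + \<beta> - 1 < 0\<close>, because \<open>\<beta> > 1 / 2\<close>.  The probability
  that the bound fails is therefore at most a multiple of \<open>exp (- c * N\<^sup>\<gamma>)\<close> for some \<open>c, \<gamma> > 0\<close>, which is summable even
  against the \<open>N\<^sup>2\<close> choices of \<open>s\<close> and \<open>t\<close>, and the Borel-Cantelli lemma applies
  (\<open>brownian_refinement_bound\<close>).  Hoelder continuity of both processes follows from the same
  Borel-Cantelli argument for single increments.
\<close>

section \<open>Hoelder continuity and equidistant grids\<close>

definition grid :: "real \<Rightarrow> nat \<Rightarrow> nat \<Rightarrow> real" where
  "grid T N k = real k * T / real N"

definition holder_on :: "real \<Rightarrow> real \<Rightarrow> (real \<Rightarrow> real) \<Rightarrow> bool" where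
  "holder_on T a f \<longleftrightarrow>
     (\<exists>C\<ge>0. \<forall>s t. 0 \<le> s \<longrightarrow> s \<le> t \<longrightarrow> t \<le> T \<longrightarrow> \<bar>f t - f s\<bar> \<le> C * (t - s) powr a)"

text \<open>A scalar entry of the matrix-valued Riemann sum, restricted to equidistant grids and with the
  number of cells as the only parameter of the partition.\<close>

definition grid_sum :: "real \<Rightarrow> nat \<Rightarrow> (real \<Rightarrow> real) \<Rightarrow> (real \<Rightarrow> real) \<Rightarrow> real \<Rightarrow> real" where
  "grid_sum T N f g t =
     (\<Sum>k<N. f (grid T N k) * (g (min (grid T N (Suc k)) t) - g (min (grid T N k) t)))"

text \<open>The change of the Riemann sum over cell \<open>j\<close> when the cell is cut into \<open>q\<close> equal pieces: this is the
  discrete area between \<open>f\<close> and \<open>g\<close> over that cell.\<close>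

definition cell_area :: "real \<Rightarrow> nat \<Rightarrow> nat \<Rightarrow> (real \<Rightarrow> real) \<Rightarrow> (real \<Rightarrow> real) \<Rightarrow> nat \<Rightarrow> real" where
  "cell_area T N q f g j =
     (\<Sum>c<q. (f (grid T (N * q) (j * q + c)) - f (grid T N j)) *
             (g (grid T (N * q) (Suc (j * q + c))) - g (grid T (N * q) (j * q + c))))"

definition refinement_bound ::
  "real \<Rightarrow> real \<Rightarrow> real \<Rightarrow> (real \<Rightarrow> real) \<Rightarrow> (real \<Rightarrow> real) \<Rightarrow> bool" where
  "refinement_bound T \<eta> \<beta> f g \<longleftrightarrow>
     (\<forall>q\<ge>1. \<exists>K\<ge>0. \<forall>N\<ge>1. \<forall>k l. k < l \<longrightarrow> l \<le> N \<longrightarrow>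
        \<bar>\<Sum>j=k..<l. cell_area T N q f g j\<bar> \<le>
          K * (T / real N) powr \<eta> * (grid T N l - grid T N k) powr \<beta>)"

lemma grid_0 [simp]: "grid T N 0 = 0"
  by (simp add: grid_def)

lemma grid_end [simp]: "N \<ge> 1 \<Longrightarrow> grid T N N = T"
  by (simp add: grid_def)

lemma grid_mono: "T > 0 \<Longrightarrow> k \<le> l \<Longrightarrow> grid T N k \<le> grid T N l"
  by (auto simp: grid_def intro!: divide_right_mono mult_right_mono)

lemma grid_nonneg: "T > 0 \<Longrightarrow> 0 \<le> grid T N k"
  by (simp add: grid_def)

lemma grid_le: "T > 0 \<Longrightarrow> k \<le> N \<Longrightarrow> grid T N k \<le> T"
  by (cases "N = 0") (auto simp: grid_def field_simps)

lemma grid_Suc: "grid T N (Suc k) = grid T N k + T / real N"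
  by (simp add: grid_def field_simps add_divide_distrib)

lemma grid_diff: "k \<le> l \<Longrightarrow> grid T N l - grid T N k = real (l - k) * (T / real N)"
  by (simp add: grid_def of_nat_diff field_simps diff_divide_distrib)

lemma grid_refine: "q \<ge> 1 \<Longrightarrow> grid T (N * q) (k * q) = grid T N k"
  by (simp add: grid_def field_simps)

lemma grid_cell:
  assumes "T > 0" "N \<ge> 1" "0 \<le> t" "t \<le> T"
  obtains k where "k < N" "grid T N k \<le> t" "t \<le> grid T N (Suc k)" "t < T \<Longrightarrow> t < grid T N (Suc k)"
proof (cases "t = T")
  case True
  then show ?thesis
    using assms that[of "N - 1"] grid_le[of T "N - 1" N] by auto
next
  case False
  let ?x = "t * real N / T"
  have x0: "0 \<le> ?x" using assms by auto
  have xN: "?x < real N" using assms False by (simp add: field_simps)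
  obtain k :: nat where k: "real k \<le> ?x" "?x < real k + 1"
    using that[of "nat \<lfloor>?x\<rfloor>"] x0 by (simp add: of_nat_nat)
  show ?thesis
  proof (rule that[of k])
    show "k < N" using k(1) xN by linarith
    show "grid T N k \<le> t" using k(1) assms by (simp add: grid_def field_simps)
    show "t < grid T N (Suc k)" using k(2) assms by (simp add: grid_def field_simps)
    then show "t \<le> grid T N (Suc k)" by simp
  qed
qed

lemma geometric_steps_bound:
  fixes x :: "nat \<Rightarrow> real"
  assumes "\<And>m. \<bar>x (Suc m) - x m\<bar> \<le> A * r ^ m" "0 \<le> r" "r < 1" "0 \<le> A"
  shows "\<bar>x m - x 0\<bar> \<le> A / (1 - r)"
proof -
  have "x m - x 0 = (\<Sum>i<m. x (Suc i) - x i)"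
    by (rule sum_lessThan_telescope[symmetric])
  also have "\<bar>\<dots>\<bar> \<le> (\<Sum>i<m. A * r ^ i)"
    using assms(1) by (intro order.trans[OF sum_abs] sum_mono)
  also have "\<dots> = A * (\<Sum>i<m. r ^ i)" by (simp add: sum_distrib_left)
  also have "(\<Sum>i<m. r ^ i) \<le> 1 / (1 - r)"
    using assms by (simp add: sum_gp_strict divide_right_mono)
  finally show ?thesis using assms by (simp add: mult_left_mono)
qed

lemma geometric_steps_convergent:
  fixes x :: "nat \<Rightarrow> real"
  assumes "\<And>m. \<bar>x (Suc m) - x m\<bar> \<le> A * r ^ m" "0 \<le> r" "r < 1"
  shows "convergent x"
proof -
  have "summable (\<lambda>m. x (Suc m) - x m)"
  proof (rule summable_comparison_test')
    show "summable (\<lambda>m. A * r ^ m)"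
      by (rule summable_mult, rule summable_geometric) (use assms in auto)
  qed (use assms in auto)
  then show ?thesis
    by (simp add: summable_iff_convergent sum_lessThan_telescope convergent_diff_const_right_iff)
qed

lemma geometric_steps_limit:
  fixes x :: "nat \<Rightarrow> real"
  assumes "\<And>m. \<bar>x (Suc m) - x m\<bar> \<le> A * r ^ m" "0 \<le> r" "r < 1" "0 \<le> A" "x \<longlonglongrightarrow> L"
  shows "\<bar>L - x 0\<bar> \<le> A / (1 - r)"
proof (rule LIMSEQ_le_const2)
  show "(\<lambda>m. \<bar>x m - x 0\<bar>) \<longlonglongrightarrow> \<bar>L - x 0\<bar>"
    by (intro tendsto_intros assms)
  show "\<exists>N. \<forall>n\<ge>N. \<bar>x n - x 0\<bar> \<le> A / (1 - r)"
    using geometric_steps_bound[OF assms(1-4)] by blast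
qed

lemma holder_on_D:
  assumes "holder_on T a f"
  obtains C where "C \<ge> 0" "\<And>s t. 0 \<le> s \<Longrightarrow> s \<le> t \<Longrightarrow> t \<le> T \<Longrightarrow> \<bar>f t - f s\<bar> \<le> C * (t - s) powr a"
  using assms by (auto simp: holder_on_def)

lemma holder_on_weaken:
  assumes "holder_on T b f" "a \<le> b"
  shows "holder_on T a f"
proof -
  obtain C where C: "C \<ge> 0" "\<And>s t. 0 \<le> s \<Longrightarrow> s \<le> t \<Longrightarrow> t \<le> T \<Longrightarrow> \<bar>f t - f s\<bar> \<le> C * (t - s) powr b"
    using holder_on_D[OF assms(1)] by blast
  have "\<bar>f t - f s\<bar> \<le> (C * T powr (b - a)) * (t - s) powr a" if "0 \<le> s" "s \<le> t" "t \<le> T" for s t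
  proof -
    have "(t - s) powr b = (t - s) powr (b - a) * (t - s) powr a"
      using powr_add[of "t - s" "b - a" a] by simp
    also have "\<dots> \<le> T powr (b - a) * (t - s) powr a"
      using that assms by (intro mult_right_mono powr_mono2) auto
    finally have "C * (t - s) powr b \<le> C * (T powr (b - a) * (t - s) powr a)"
      using C(1) by (rule mult_left_mono)
    then show ?thesis
      using C(2)[OF that] by (simp add: mult.assoc)
  qed
  then show ?thesis using C(1) by (auto simp: holder_on_def intro!: exI[of _ "C * T powr (b - a)"])
qed

lemma holder_on_continuous:
  assumes "holder_on T a f" "a > 0"
  shows "continuous_on {0..T} f"
proof -
  obtain C where C: "C \<ge> 0" "\<And>s t. 0 \<le> s \<Longrightarrow> s \<le> t \<Longrightarrow> t \<le> T \<Longrightarrow> \<bar>f t - f s\<bar> \<le> C * (t - s) powr a"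
    using holder_on_D[OF assms(1)] by blast
  have C': "\<bar>f t - f s\<bar> \<le> C * \<bar>t - s\<bar> powr a" if "s \<in> {0..T}" "t \<in> {0..T}" for s t
    using C(2)[of s t] C(2)[of t s] that by (cases "s \<le> t") (auto simp: abs_minus_commute)
  show ?thesis unfolding continuous_on_def
  proof
    fix s assume s: "s \<in> {0..T}"
    have "((\<lambda>t. f t - f s) \<longlongrightarrow> 0) (at s within {0..T})"
    proof (rule Lim_null_comparison)
      show "\<forall>\<^sub>F t in at s within {0..T}. norm (f t - f s) \<le> C * \<bar>t - s\<bar> powr a"
        using C'[OF s] by (auto simp: eventually_at_filter)
      have "((\<lambda>t. \<bar>t - s\<bar> powr a) \<longlongrightarrow> 0) (at s within {0..T})"
      proof (rule tendsto_zero_powrI)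
        show "((\<lambda>t. \<bar>t - s\<bar>) \<longlongrightarrow> 0) (at s within {0..T})"
          by (rule tendsto_eq_intros refl | simp)+
      qed (use assms in auto)
      then show "((\<lambda>t. C * \<bar>t - s\<bar> powr a) \<longlongrightarrow> 0) (at s within {0..T})"
        by (rule tendsto_mult_right_zero)
    qed
    then show "(f \<longlongrightarrow> f s) (at s within {0..T})" by (simp add: LIM_zero_iff)
  qed
qed

text \<open>Dyadic chaining: \<open>X t\<close> is reached from its value at the dyadic point below \<open>t\<close> by a sequence of
  increments over single cells of finer and finer grids, whose sizes form a geometric series.  Two
  times at distance about one cell lie in the same cell or in neighbouring ones.\<close>

lemma holder_from_grid_increments:
  assumes T: "T > 0" and a: "a > 0" and cont: "continuous_on {0..T} X"
    and K: "K \<ge> 0" "\<And>N k. N \<ge> 1 \<Longrightarrow> k < N \<Longrightarrow>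
      \<bar>X (grid T N (Suc k)) - X (grid T N k)\<bar> \<le> K * (T / real N) powr a"
  shows "holder_on T a X"
proof -
  define ix where "ix = (\<lambda>m t. nat \<lfloor>t * 2 ^ m / T\<rfloor>)"
  define y where "y = (\<lambda>m t. grid T (2 ^ m) (ix m t))"
  define h where "h = (\<lambda>m. T / 2 ^ m)"
  define r where "r = (1/2::real) powr a"
  have r: "0 \<le> r" "r < 1" using a by (auto simp: r_def powr_def ln_div)
  have K': "\<bar>X (grid T (2 ^ m) (Suc k)) - X (grid T (2 ^ m) k)\<bar> \<le> K * h m powr a"
    if "k < 2 ^ m" for m k using K(2)[of "2 ^ m" k] that by (simp add: h_def)
  have ixr: "real (ix m t) \<le> t * 2 ^ m / T" "t * 2 ^ m / T < real (ix m t) + 1" if "0 \<le> t" for m t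
    using that T by (auto simp: ix_def of_nat_nat)
  have ix_le: "ix m t \<le> 2 ^ m" if "0 \<le> t" "t \<le> T" for m t
  proof -
    have "t * 2 ^ m / T \<le> 2 ^ m" using that T by (simp add: field_simps)
    then have "real (ix m t) \<le> real (2 ^ m)"
      unfolding of_nat_power of_nat_numeral using ixr(1)[OF that(1), of m] by linarith
    then show ?thesis by (simp only: of_nat_le_iff)
  qed
  have y: "y m t \<le> t" "t < y m t + h m" if "0 \<le> t" for m t
  proof -
    have "real (ix m t) * T \<le> t * 2 ^ m" "t * 2 ^ m < (real (ix m t) + 1) * T"
      using ixr[OF that, of m] T by (simp_all add: pos_le_divide_eq pos_divide_less_eq)
    then show "y m t \<le> t" "t < y m t + h m"
      by (simp_all add: y_def grid_def h_def pos_divide_le_eq add_divide_distrib[symmetric]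
          pos_less_divide_eq algebra_simps)
  qed
  have y0: "0 \<le> y m t" for m t using T by (simp add: y_def grid_def)
  have h_Suc: "h (Suc m) = h m / 2" for m by (simp add: h_def)
  have hpow: "h (i + m) powr a = h i powr a * r ^ m" for i m
  proof -
    have "h (i + m) = h i * (1/2) ^ m" by (simp add: h_def power_add power_one_over)
    then have "h (i + m) powr a = h i powr a * ((1/2) ^ m) powr a"
      using powr_mult[of "h i" "(1/2) ^ m" a] T by (simp add: h_def)
    also have "((1/2::real) ^ m) powr a = ((1/2) powr real m) powr a"
      by (simp add: powr_realpow)
    also have "\<dots> = (1/2) powr (real m * a)" by (rule powr_powr)
    also have "\<dots> = r ^ m" by (simp add: r_def powr_power)
    finally show ?thesis .
  qed
  \<comment> \<open>one refinement moves the approximating grid point by at most one finer cell\<close>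
  have step: "\<bar>X (y (Suc m) t) - X (y m t)\<bar> \<le> K * h m powr a" if t: "0 \<le> t" "t \<le> T" for m t
  proof -
    have "ix (Suc m) t = 2 * ix m t \<or> ix (Suc m) t = Suc (2 * ix m t)"
    proof -
      have "real (ix (Suc m) t) < real (2 * ix m t + 2)" "real (2 * ix m t) < real (ix (Suc m) t + 1)"
        using ixr[OF t(1), of m] ixr[OF t(1), of "Suc m"]
        unfolding power_Suc mult.left_commute[of t 2] times_divide_eq_right[symmetric, of 2]
        by simp_all
      then show ?thesis by linarith
    qed
    moreover have ym: "y m t = grid T (2 ^ Suc m) (2 * ix m t)"
      using grid_refine[of 2 T "2 ^ m" "ix m t"] by (simp add: y_def mult.commute)
    moreover have "h (Suc m) powr a \<le> h m powr a" using T a by (intro powr_mono2) (auto simp: h_def field_simps)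
    ultimately show ?thesis
    proof (elim disjE)
      assume "ix (Suc m) t = 2 * ix m t"
      then have "y (Suc m) t = y m t" unfolding ym by (simp add: y_def)
      then show ?thesis using K by simp
    next
      assume e: "ix (Suc m) t = Suc (2 * ix m t)"
      then have "2 * ix m t < 2 ^ Suc m" using ix_le[OF t, of "Suc m"] by simp
      from K'[OF this] have "\<bar>X (y (Suc m) t) - X (y m t)\<bar> \<le> K * h (Suc m) powr a"
        unfolding ym by (simp add: y_def e)
      also have "\<dots> \<le> K * h m powr a" using \<open>h (Suc m) powr a \<le> h m powr a\<close> K(1) by (rule mult_left_mono)
      finally show ?thesis .
    qed
  qed
  have app: "\<bar>X t - X (y i t)\<bar> \<le> K * h i powr a / (1 - r)" if t: "0 \<le> t" "t \<le> T" for i t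
  proof -
    have "(\<lambda>m. y (m + i) t) \<longlonglongrightarrow> t"
    proof (rule LIMSEQ_ignore_initial_segment, rule tendsto_sandwich)
      have "(\<lambda>m. T / 2 ^ m) \<longlonglongrightarrow> 0" using LIMSEQ_divide_realpow_zero[of 2 T] by simp
      from tendsto_diff[OF tendsto_const this, of t]
      show "(\<lambda>m. t - h m) \<longlonglongrightarrow> t" by (simp add: h_def)
      show "\<forall>\<^sub>F m in sequentially. t - h m \<le> y m t" "\<forall>\<^sub>F m in sequentially. y m t \<le> t"
        using y[OF t(1)] by (auto intro!: always_eventually less_imp_le simp: diff_less_eq)
    qed simp
    then have lim: "(\<lambda>m. X (y (m + i) t)) \<longlonglongrightarrow> X t"
      by (rule continuous_on_tendsto_compose[OF cont])
        (use t y(1)[OF t(1)] y0 in \<open>auto intro!: always_eventually intro: order_trans[OF _ t(2)]\<close>)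
    have "\<bar>X (y (Suc m + i) t) - X (y (m + i) t)\<bar> \<le> K * h i powr a * r ^ m" for m
      using step[OF t, of "m + i"] hpow[of i m] by (simp add: add.commute mult.assoc)
    from geometric_steps_limit[OF this r _ lim] show ?thesis using K by simp
  qed
  define C where "C = (K * (2 / (1 - r)) + K) * 2 powr a"
  have "\<bar>X t - X s\<bar> \<le> C * (t - s) powr a" if st: "0 \<le> s" "s \<le> t" "t \<le> T" for s t
  proof (cases "s = t")
    case False
    then have d: "0 < t - s" using st by simp
    \<comment> \<open>the level with \<open>h i / 2 < t - s \<le> h i\<close>\<close>
    have "\<exists>i. h i < t - s"
    proof -
      have "(\<lambda>m. T / 2 ^ m) \<longlonglongrightarrow> 0" using LIMSEQ_divide_realpow_zero[of 2 T] by simp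
      then have "\<forall>\<^sub>F m in sequentially. h m < t - s" unfolding h_def by (rule order_tendstoD(2)) (rule d)
      then show ?thesis by (auto simp: eventually_sequentially)
    qed
    define i where "i = (LEAST i. h i < t - s)"
    have i: "h i < t - s" unfolding i_def using \<open>\<exists>i. h i < t - s\<close> by (rule LeastI_ex)
    have "i \<noteq> 0" using i st by (auto simp: h_def intro: Nat.gr0I)
    then obtain m where m: "i = Suc m" using not0_implies_Suc by blast
    have hm: "t - s \<le> h m" using not_less_Least[of m "\<lambda>i. h i < t - s"] m by (auto simp: i_def)
    have hm2: "h m < 2 * (t - s)" using i m h_Suc[of m] by simp
    have "ix m t = ix m s \<or> ix m t = Suc (ix m s)"
    proof -
      have "t * 2 ^ m / T \<le> s * 2 ^ m / T + 1" using hm T by (simp add: h_def field_simps)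
      moreover have "s * 2 ^ m / T \<le> t * 2 ^ m / T" using st T by (auto intro!: divide_right_mono)
      ultimately have "real (ix m t) < real (ix m s + 2)" "real (ix m s) < real (ix m t + 1)"
        using ixr[of s m] ixr[of t m] st by auto
      then show ?thesis by linarith
    qed
    then have "\<bar>X (y m t) - X (y m s)\<bar> \<le> K * h m powr a"
    proof
      assume e: "ix m t = Suc (ix m s)"
      then have "ix m s < 2 ^ m" using ix_le[of t m] st by simp
      then show ?thesis using K' by (simp add: y_def e)
    qed (use K in \<open>simp add: y_def\<close>)
    then have "\<bar>X t - X s\<bar> \<le> K * h m powr a / (1 - r) + K * h m powr a / (1 - r) + K * h m powr a"
      using app[of t m] app[of s m] st by linarith
    also have "\<dots> = (K * (2 / (1 - r)) + K) * h m powr a" by (simp add: field_simps)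
    also have "\<dots> \<le> (K * (2 / (1 - r)) + K) * (2 * (t - s)) powr a"
      using hm2 K r a T by (intro mult_left_mono powr_mono2) (auto simp: h_def)
    also have "\<dots> = C * (t - s) powr a" using powr_mult[of 2 "t - s" a] d by (simp add: C_def)
    finally show ?thesis .
  qed simp
  moreover have "C \<ge> 0" using K r by (auto simp: C_def)
  ultimately show ?thesis unfolding holder_on_def by blast
qed

section \<open>Riemann sums under refinement of the grid\<close>

text \<open>The cell area with the integrator stopped at time \<open>t\<close>; it interpolates between 0 and
  \<^const>\<open>cell_area\<close> while \<open>t\<close> runs through the cell, and thus describes the difference of two Riemann
  sums also between grid points.\<close>

definition partial_cell_area ::
  "real \<Rightarrow> nat \<Rightarrow> nat \<Rightarrow> (real \<Rightarrow> real) \<Rightarrow> (real \<Rightarrow> real) \<Rightarrow> real \<Rightarrow> nat \<Rightarrow> real" where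
  "partial_cell_area T N q f g t j =
     (\<Sum>c<q. (f (grid T (N * q) (j * q + c)) - f (grid T N j)) *
             (g (min (grid T (N * q) (Suc (j * q + c))) t) - g (min (grid T (N * q) (j * q + c)) t)))"

lemma grid_sum_0 [simp]: "T > 0 \<Longrightarrow> grid_sum T N f g 0 = 0"
  by (simp add: grid_sum_def grid_nonneg min_absorb2)

lemma grid_sum_cell:
  assumes T: "T > 0" and k: "k < N" and t: "grid T N k \<le> t" "t \<le> grid T N (Suc k)"
  shows "grid_sum T N f g t = grid_sum T N f g (grid T N k) + f (grid T N k) * (g t - g (grid T N k))"
proof -
  let ?e = "\<lambda>t j. f (grid T N j) * (g (min (grid T N (Suc j)) t) - g (min (grid T N j) t))"
  have "grid_sum T N f g t - grid_sum T N f g (grid T N k) = (\<Sum>j<N. ?e t j - ?e (grid T N k) j)"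
    by (simp add: grid_sum_def sum_subtractf)
  also have "\<dots> = (\<Sum>j<N. if j = k then f (grid T N k) * (g t - g (grid T N k)) else 0)"
  proof (intro sum.cong refl)
    fix j assume "j \<in> {..<N}"
    consider "j < k" | "j = k" | "j > k" by linarith
    then show "?e t j - ?e (grid T N k) j = (if j = k then f (grid T N k) * (g t - g (grid T N k)) else 0)"
    proof cases
      case 1
      then have "grid T N (Suc j) \<le> grid T N k" "grid T N j \<le> grid T N k"
        using T by (auto intro!: grid_mono)
      then show ?thesis using t 1 by (simp add: min_absorb1)
    next
      case 2
      then show ?thesis using t by (simp add: min_absorb1 min_absorb2)
    next
      case 3
      then have "grid T N (Suc k) \<le> grid T N j" "grid T N j \<le> grid T N (Suc j)"
        using T by (auto intro!: grid_mono)
      then show ?thesis using t 3 by (simp add: min_absorb1 min_absorb2)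
    qed
  qed
  also have "\<dots> = f (grid T N k) * (g t - g (grid T N k))"
    using k by simp
  finally show ?thesis by simp
qed

lemma grid_sum_refine_diff:
  assumes T: "T > 0" and q: "q \<ge> 1"
  shows "grid_sum T (N * q) f g t - grid_sum T N f g t = (\<Sum>j<N. partial_cell_area T N q f g t j)"
proof -
  let ?G = "\<lambda>r. g (min (grid T (N * q) r) t)"
  have "grid_sum T (N * q) f g t = (\<Sum>j<N. \<Sum>r=j*q..<j*q+q. f (grid T (N * q) r) * (?G (Suc r) - ?G r))"
    unfolding grid_sum_def by (rule sum.nat_group[symmetric])
  also have "\<dots> = (\<Sum>j<N. \<Sum>c<q. f (grid T (N * q) (j * q + c)) * (?G (Suc (j * q + c)) - ?G (j * q + c)))"
  proof (rule sum.cong[OF refl])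
    fix j
    show "(\<Sum>r=j*q..<j*q+q. f (grid T (N * q) r) * (?G (Suc r) - ?G r)) =
      (\<Sum>c<q. f (grid T (N * q) (j * q + c)) * (?G (Suc (j * q + c)) - ?G (j * q + c)))"
      by (rule sum.reindex_bij_witness[of _ "\<lambda>c. j * q + c" "\<lambda>r. r - j * q"]) auto
  qed
  finally have fine: "grid_sum T (N * q) f g t =
    (\<Sum>j<N. \<Sum>c<q. f (grid T (N * q) (j * q + c)) * (?G (Suc (j * q + c)) - ?G (j * q + c)))" .
  have tele: "g (min (grid T N (Suc j)) t) - g (min (grid T N j) t) =
      (\<Sum>c<q. ?G (Suc (j * q + c)) - ?G (j * q + c))" for j
  proof -
    have "(\<Sum>c<q. ?G (j * q + Suc c) - ?G (j * q + c)) = ?G (j * q + q) - ?G (j * q + 0)"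
      by (rule sum_lessThan_telescope)
    moreover have "?G (j * q + q) = g (min (grid T N (Suc j)) t)"
      using grid_refine[OF q, of T N "Suc j"] by (simp add: add.commute)
    moreover have "?G (j * q) = g (min (grid T N j) t)"
      using grid_refine[OF q, of T N j] by simp
    ultimately show ?thesis by simp
  qed
  have coarse: "grid_sum T N f g t = (\<Sum>j<N. \<Sum>c<q. f (grid T N j) * (?G (Suc (j * q + c)) - ?G (j * q + c)))"
    unfolding grid_sum_def tele sum_distrib_left ..
  show ?thesis
    unfolding fine coarse partial_cell_area_def sum_subtractf[symmetric] left_diff_distrib[symmetric] ..
qed

lemma fine_grid_in_cell:
  assumes T: "T > 0" and c: "c \<le> q" and q: "q \<ge> 1"
  shows "grid T N j \<le> grid T (N * q) (j * q + c)" "grid T (N * q) (j * q + c) \<le> grid T N (Suc j)"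
proof -
  have "grid T (N * q) (j * q) \<le> grid T (N * q) (j * q + c)" using T by (intro grid_mono) auto
  then show "grid T N j \<le> grid T (N * q) (j * q + c)" by (simp add: grid_refine[OF q])
  have "grid T (N * q) (j * q + c) \<le> grid T (N * q) (Suc j * q)" using T c by (intro grid_mono) auto
  then show "grid T (N * q) (j * q + c) \<le> grid T N (Suc j)" unfolding grid_refine[OF q] .
qed

lemma partial_cell_area_before:
  assumes "T > 0" "q \<ge> 1" "t \<le> grid T N j"
  shows "partial_cell_area T N q f g t j = 0"
proof -
  have "min (grid T (N * q) (j * q + c)) t = t" "min (grid T (N * q) (Suc (j * q + c))) t = t" if "c < q" for c
    using fine_grid_in_cell(1)[of T c q N j] fine_grid_in_cell(1)[of T "Suc c" q N j] assms that by auto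
  then show ?thesis by (auto simp: partial_cell_area_def intro!: sum.neutral)
qed

lemma partial_cell_area_after:
  assumes "T > 0" "q \<ge> 1" "grid T N (Suc j) \<le> t"
  shows "partial_cell_area T N q f g t j = cell_area T N q f g j"
proof -
  have "min (grid T (N * q) (j * q + c)) t = grid T (N * q) (j * q + c)"
    "min (grid T (N * q) (Suc (j * q + c))) t = grid T (N * q) (Suc (j * q + c))" if "c < q" for c
    using fine_grid_in_cell(2)[of T c q N j] fine_grid_in_cell(2)[of T "Suc c" q N j] assms that by auto
  then show ?thesis by (auto simp: partial_cell_area_def cell_area_def intro!: sum.cong)
qed

lemma grid_sum_refine_diff_cell:
  assumes T: "T > 0" and q: "q \<ge> 1" and k: "k < N" and t: "grid T N k \<le> t" "t \<le> grid T N (Suc k)"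
  shows "grid_sum T (N * q) f g t - grid_sum T N f g t =
    (\<Sum>j<k. cell_area T N q f g j) + partial_cell_area T N q f g t k"
proof -
  have "(\<Sum>j<N. partial_cell_area T N q f g t j) = (\<Sum>j<Suc k. partial_cell_area T N q f g t j)"
  proof (rule sum.mono_neutral_right)
    show "\<forall>j\<in>{..<N} - {..<Suc k}. partial_cell_area T N q f g t j = 0"
    proof
      fix j assume "j \<in> {..<N} - {..<Suc k}"
      then have "grid T N (Suc k) \<le> grid T N j" using T by (intro grid_mono) auto
      then show "partial_cell_area T N q f g t j = 0"
        using T q t by (intro partial_cell_area_before) auto
    qed
  qed (use k in auto)
  also have "\<dots> = (\<Sum>j<k. partial_cell_area T N q f g t j) + partial_cell_area T N q f g t k"
    by simp
  also have "(\<Sum>j<k. partial_cell_area T N q f g t j) = (\<Sum>j<k. cell_area T N q f g j)"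
  proof (intro sum.cong refl partial_cell_area_after T q)
    fix j assume "j \<in> {..<k}"
    then have "grid T N (Suc j) \<le> grid T N k" using T by (intro grid_mono) auto
    then show "grid T N (Suc j) \<le> t" using t by simp
  qed
  finally show ?thesis by (simp add: grid_sum_refine_diff[OF T q])
qed

lemma partial_cell_area_bound:
  assumes T: "T > 0" and q: "q \<ge> 1" and N: "k < N" and t: "grid T N k \<le> t" "t \<le> grid T N (Suc k)"
    and C: "C \<ge> 0" "D \<ge> 0" "a > 0" "b > 0"
    and f: "\<And>s t. 0 \<le> s \<Longrightarrow> s \<le> t \<Longrightarrow> t \<le> T \<Longrightarrow> \<bar>f t - f s\<bar> \<le> C * (t - s) powr a"
    and g: "\<And>s t. 0 \<le> s \<Longrightarrow> s \<le> t \<Longrightarrow> t \<le> T \<Longrightarrow> \<bar>g t - g s\<bar> \<le> D * (t - s) powr b"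
  shows "\<bar>partial_cell_area T N q f g t k\<bar> \<le> real q * (C * D * (T / real N) powr (a + b))"
proof -
  let ?h = "T / real N"
  have kT: "0 \<le> grid T N k" "grid T N (Suc k) \<le> T"
    using T N by (auto intro!: grid_nonneg grid_le)
  have "\<bar>(f (grid T (N * q) (k * q + c)) - f (grid T N k)) *
             (g (min (grid T (N * q) (Suc (k * q + c))) t) - g (min (grid T (N * q) (k * q + c)) t))\<bar>
      \<le> C * D * ?h powr (a + b)" if c: "c < q" for c
  proof -
    let ?x = "grid T (N * q) (k * q + c)" and ?y = "grid T (N * q) (Suc (k * q + c))"
    have x: "grid T N k \<le> ?x" "?x \<le> grid T N (Suc k)" "?x \<le> ?y" "?y \<le> grid T N (Suc k)"
      using fine_grid_in_cell[of T c q N k] fine_grid_in_cell[of T "Suc c" q N k] T q c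
      by (auto intro!: grid_mono)
    have "\<bar>f ?x - f (grid T N k)\<bar> \<le> C * (?x - grid T N k) powr a"
      using x kT by (intro f) auto
    also have "\<dots> \<le> C * ?h powr a"
      using x C grid_Suc[of T N k] by (intro mult_left_mono powr_mono2) auto
    finally have 1: "\<bar>f ?x - f (grid T N k)\<bar> \<le> C * ?h powr a" .
    have "\<bar>g (min ?y t) - g (min ?x t)\<bar> \<le> D * (min ?y t - min ?x t) powr b"
      using x kT t by (intro g) (auto simp: min_def)
    also have "\<dots> \<le> D * ?h powr b"
      using x t C grid_Suc[of T N k] by (intro mult_left_mono powr_mono2) (auto simp: min_def)
    finally have 2: "\<bar>g (min ?y t) - g (min ?x t)\<bar> \<le> D * ?h powr b" .
    have "\<bar>f ?x - f (grid T N k)\<bar> * \<bar>g (min ?y t) - g (min ?x t)\<bar> \<le> (C * ?h powr a) * (D * ?h powr b)"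
      using C by (intro mult_mono 1 2) auto
    then show ?thesis by (simp add: abs_mult powr_add ac_simps)
  qed
  then have "\<bar>partial_cell_area T N q f g t k\<bar> \<le> (\<Sum>c<q. C * D * ?h powr (a + b))"
    unfolding partial_cell_area_def by (intro order.trans[OF sum_abs] sum_mono) auto
  then show ?thesis by simp
qed

text \<open>Young's case \<open>a + b > 1\<close>: each of the \<open>q\<close> terms in each of the \<open>(t - s) / h\<close> cells is
  \<open>O(h\<^sup>a\<^sup>+\<^sup>b)\<close>, so the whole sum is \<open>O((t - s) * h\<^sup>\<eta>)\<close>.\<close>

lemma refinement_bound_young:
  assumes T: "T > 0" and a: "a > 0" "b > 0" and f: "holder_on T a f" and g: "holder_on T b g"
    and ab: "a + b \<ge> 1 + \<eta>" and \<beta>: "0 \<le> \<beta>" "\<beta> \<le> 1" "\<eta> > 0"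
  shows "refinement_bound T \<eta> \<beta> f g"
proof -
  obtain C where C: "C \<ge> 0" "\<And>s t. 0 \<le> s \<Longrightarrow> s \<le> t \<Longrightarrow> t \<le> T \<Longrightarrow> \<bar>f t - f s\<bar> \<le> C * (t - s) powr a"
    using holder_on_D[OF f] by blast
  obtain D where D: "D \<ge> 0" "\<And>s t. 0 \<le> s \<Longrightarrow> s \<le> t \<Longrightarrow> t \<le> T \<Longrightarrow> \<bar>g t - g s\<bar> \<le> D * (t - s) powr b"
    using holder_on_D[OF g] by blast
  show ?thesis unfolding refinement_bound_def
  proof (intro allI impI)
    fix q :: nat assume q: "q \<ge> 1"
    define K where "K = real q * C * D * T powr (a + b - 1 - \<eta>) * T powr (1 - \<beta>)"
    have "\<bar>\<Sum>j=k..<l. cell_area T N q f g j\<bar> \<le> K * (T / real N) powr \<eta> * (grid T N l - grid T N k) powr \<beta>"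
      if N: "N \<ge> 1" and kl: "k < l" "l \<le> N" for N k l
    proof -
      let ?h = "T / real N" and ?L = "grid T N l - grid T N k"
      have h: "0 < ?h" "?h \<le> T" using T N by (auto simp: field_simps)
      have L: "?L = real (l - k) * ?h" using kl by (intro grid_diff) auto
      have L0: "0 \<le> ?L" "?L \<le> T"
        using T kl grid_mono[OF T, of k l N] grid_nonneg[OF T, of N k] grid_le[OF T, of l N] by auto
      have "\<bar>cell_area T N q f g j\<bar> \<le> real q * (C * D * ?h powr (a + b))" if "j \<in> {k..<l}" for j
      proof -
        have "cell_area T N q f g j = partial_cell_area T N q f g (grid T N (Suc j)) j"
          using partial_cell_area_after[OF T q order.refl] by simp
        then show ?thesis
          using partial_cell_area_bound[OF T q _ _ _ C(1) D(1) a C(2) D(2), of j N "grid T N (Suc j)"]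
            that kl grid_mono[OF T, of j "Suc j" N] by auto
      qed
      then have "\<bar>\<Sum>j=k..<l. cell_area T N q f g j\<bar> \<le> (\<Sum>j=k..<l. real q * (C * D * ?h powr (a + b)))"
        by (intro order.trans[OF sum_abs] sum_mono)
      also have "\<dots> = (real q * C * D) * (real (l - k) * ?h powr (a + b))"
        by simp
      also have "?h powr (a + b) = ?h * ?h powr \<eta> * ?h powr (a + b - 1 - \<eta>)"
        using h powr_add[of ?h "1 + \<eta>" "a + b - 1 - \<eta>"] powr_add[of ?h 1 \<eta>] by simp
      also have "real (l - k) * (?h * ?h powr \<eta> * ?h powr (a + b - 1 - \<eta>)) =
          ?h powr (a + b - 1 - \<eta>) * (?h powr \<eta> * ?L)"
        unfolding L by (simp add: ac_simps)
      also have "?L = ?L powr (1 - \<beta>) * ?L powr \<beta>"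
        using L0 by (simp add: powr_add[symmetric])
      also have "(real q * C * D) * (?h powr (a + b - 1 - \<eta>) * (?h powr \<eta> * (?L powr (1 - \<beta>) * ?L powr \<beta>)))
        \<le> (real q * C * D) * (T powr (a + b - 1 - \<eta>) * (?h powr \<eta> * (T powr (1 - \<beta>) * ?L powr \<beta>)))"
        using C D h L0 ab \<beta> by (intro mult_left_mono mult_mono powr_mono2 mult_nonneg_nonneg) auto
      also have "\<dots> = K * ?h powr \<eta> * ?L powr \<beta>" by (simp add: K_def)
      finally show ?thesis .
    qed
    moreover have "K \<ge> 0" using C D by (simp add: K_def)
    ultimately show "\<exists>K\<ge>0. \<forall>N\<ge>1. \<forall>k l. k < l \<longrightarrow> l \<le> N \<longrightarrow>
        \<bar>\<Sum>j=k..<l. cell_area T N q f g j\<bar> \<le>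
          K * (T / real N) powr \<eta> * (grid T N l - grid T N k) powr \<beta>" by blast
  qed
qed

section \<open>The limit of the Riemann sums\<close>

text \<open>The relation \<open>2 * \<alpha> = \<beta> + \<eta>\<close> makes the product of two increments over a single cell, which is of
  order \<open>h\<close> to the power \<open>2 * \<alpha>\<close>, compatible with the refinement bound.\<close>

locale compensated_pair =
  fixes T \<alpha> \<beta> \<eta> :: real and f g :: "real \<Rightarrow> real"
  assumes T: "T > 0" and pos: "\<alpha> > 0" "\<beta> > 0" "\<eta> > 0" and expo: "2 * \<alpha> = \<beta> + \<eta>"
    and f: "holder_on T \<alpha> f" and g: "holder_on T \<alpha> g"
    and refine: "refinement_bound T \<eta> \<beta> f g"
begin

text \<open>The refinement bound extends from grid points to arbitrary times.  The two incomplete cells at the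
  ends contribute terms of order \<open>h\<close> to the power \<open>2 * \<alpha>\<close>, which is why \<open>t - s\<close> is replaced by
  \<open>t - s + h\<close>.\<close>

lemma refine_increment:
  assumes q: "q \<ge> 1"
  shows "\<exists>K\<ge>0. \<forall>N\<ge>1. \<forall>s t. 0 \<le> s \<longrightarrow> s \<le> t \<longrightarrow> t \<le> T \<longrightarrow>
     \<bar>(grid_sum T (N * q) f g t - grid_sum T N f g t) - (grid_sum T (N * q) f g s - grid_sum T N f g s)\<bar>
       \<le> K * (T / real N) powr \<eta> * (t - s + T / real N) powr \<beta>"
proof -
  obtain C where C: "C \<ge> 0" "\<And>s t. 0 \<le> s \<Longrightarrow> s \<le> t \<Longrightarrow> t \<le> T \<Longrightarrow> \<bar>f t - f s\<bar> \<le> C * (t - s) powr \<alpha>"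
    using holder_on_D[OF f] by blast
  obtain D where D: "D \<ge> 0" "\<And>s t. 0 \<le> s \<Longrightarrow> s \<le> t \<Longrightarrow> t \<le> T \<Longrightarrow> \<bar>g t - g s\<bar> \<le> D * (t - s) powr \<alpha>"
    using holder_on_D[OF g] by blast
  obtain K where K0: "K \<ge> 0" and K1: "\<forall>N\<ge>1. \<forall>k l. k < l \<longrightarrow> l \<le> N \<longrightarrow>
        \<bar>\<Sum>j=k..<l. cell_area T N q f g j\<bar> \<le>
          K * (T / real N) powr \<eta> * (grid T N l - grid T N k) powr \<beta>"
    using refine[unfolded refinement_bound_def, rule_format, OF q] by (elim exE conjE)
  note K = K0 K1[rule_format]
  let ?B = "real q * (C * D)"
  have "\<bar>(grid_sum T (N * q) f g t - grid_sum T N f g t) - (grid_sum T (N * q) f g s - grid_sum T N f g s)\<bar>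
       \<le> (K + 2 * ?B) * (T / real N) powr \<eta> * (t - s + T / real N) powr \<beta>"
    if N: "N \<ge> 1" and st: "0 \<le> s" "s \<le> t" "t \<le> T" for N s t
  proof -
    let ?h = "T / real N"
    have h: "0 < ?h" using T N by simp
    obtain k where k: "k < N" "grid T N k \<le> s" "s \<le> grid T N (Suc k)"
      using grid_cell[OF T N, of s] st by auto
    obtain l' where l': "l' < N" "grid T N l' \<le> t" "t \<le> grid T N (Suc l')"
      using grid_cell[OF T N, of t] st by auto
    \<comment> \<open>at a grid point two cells are possible; the cell of \<open>t\<close> must not precede that of \<open>s\<close>\<close>
    define l where "l = max k l'"
    have l: "k \<le> l" "l < N" "grid T N l \<le> t" "t \<le> grid T N (Suc l)"
      using k l' st grid_mono[OF T, of "Suc l'" "Suc k" N] unfolding l_def by (auto simp: max_def)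
    let ?P = "partial_cell_area T N q f g"
    have pc: "\<bar>?P u j\<bar> \<le> ?B * ?h powr \<eta> * (t - s + ?h) powr \<beta>"
      if "j < N" "grid T N j \<le> u" "u \<le> grid T N (Suc j)" for u j
    proof -
      have "\<bar>?P u j\<bar> \<le> real q * (C * D * ?h powr (\<alpha> + \<alpha>))"
        using C D T q that pos by (intro partial_cell_area_bound) auto
      also have "\<alpha> + \<alpha> = \<eta> + \<beta>" using expo by simp
      also have "real q * (C * D * ?h powr (\<eta> + \<beta>)) = ?B * ?h powr \<eta> * ?h powr \<beta>"
        by (simp add: powr_add)
      also have "\<dots> \<le> ?B * ?h powr \<eta> * (t - s + ?h) powr \<beta>"
        using C D h st pos by (intro mult_left_mono powr_mono2) auto
      finally show ?thesis .
    qed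
    have main: "\<bar>\<Sum>j=k..<l. cell_area T N q f g j\<bar> \<le> K * ?h powr \<eta> * (t - s + ?h) powr \<beta>"
    proof (cases "k < l")
      case True
      have "grid T N l - grid T N k \<le> t - s + ?h" using k l grid_Suc[of T N k] by simp
      then have "K * ?h powr \<eta> * (grid T N l - grid T N k) powr \<beta> \<le> K * ?h powr \<eta> * (t - s + ?h) powr \<beta>"
        using K(1) l(1) T pos by (intro mult_left_mono powr_mono2) (auto intro: grid_mono)
      with K(2)[OF N True] l show ?thesis by linarith
    qed (use K l in simp)
    have "(\<Sum>j<l. cell_area T N q f g j) = (\<Sum>j<k. cell_area T N q f g j) + (\<Sum>j=k..<l. cell_area T N q f g j)"
      using sum.atLeastLessThan_concat[of 0 k l "cell_area T N q f g"] l(1) by (simp add: lessThan_atLeast0)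
    then have "(grid_sum T (N * q) f g t - grid_sum T N f g t) - (grid_sum T (N * q) f g s - grid_sum T N f g s)
      = (\<Sum>j=k..<l. cell_area T N q f g j) + ?P t l - ?P s k"
      using grid_sum_refine_diff_cell[OF T q k, of f g] grid_sum_refine_diff_cell[OF T q l(2-4), of f g] by simp
    also have "\<bar>\<dots>\<bar> \<le> K * ?h powr \<eta> * (t - s + ?h) powr \<beta> + ?B * ?h powr \<eta> * (t - s + ?h) powr \<beta>
       + ?B * ?h powr \<eta> * (t - s + ?h) powr \<beta>"
      using main pc[OF k] pc[OF l(2-4)] by linarith
    also have "\<dots> = (K + 2 * ?B) * ?h powr \<eta> * (t - s + ?h) powr \<beta>"
      by (simp add: algebra_simps)
    finally show ?thesis .
  qed
  moreover have "K + 2 * ?B \<ge> 0" using K C D by auto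
  ultimately show ?thesis by blast
qed

text \<open>The limit is taken along repeated doubling of a given grid; a priori it depends on the initial
  grid.\<close>

definition integral_limit :: "nat \<Rightarrow> real \<Rightarrow> real" where
  "integral_limit N t = lim (\<lambda>m. grid_sum T (N * 2 ^ m) f g t)"

text \<open>Iterating the bound for \<open>q = 2\<close>: the factor \<open>h\<^sup>\<eta>\<close> turns the successive errors into a geometric
  series.\<close>

lemma grid_sum_to_limit:
  "\<exists>K\<ge>0. \<forall>N\<ge>1. \<forall>s t. 0 \<le> s \<longrightarrow> s \<le> t \<longrightarrow> t \<le> T \<longrightarrow>
     (\<lambda>m. grid_sum T (N * 2 ^ m) f g t) \<longlonglongrightarrow> integral_limit N t \<and>
     \<bar>(integral_limit N t - grid_sum T N f g t) - (integral_limit N s - grid_sum T N f g s)\<bar>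
       \<le> K * (T / real N) powr \<eta> * (t - s + T / real N) powr \<beta>"
proof -
  obtain K where K: "K \<ge> 0" and Kb: "\<And>N s t. N \<ge> 1 \<Longrightarrow> 0 \<le> s \<Longrightarrow> s \<le> t \<Longrightarrow> t \<le> T \<Longrightarrow>
     \<bar>(grid_sum T (N * 2) f g t - grid_sum T N f g t) - (grid_sum T (N * 2) f g s - grid_sum T N f g s)\<bar>
       \<le> K * (T / real N) powr \<eta> * (t - s + T / real N) powr \<beta>"
    using refine_increment[of 2] by auto
  define r where "r = (1/2::real) powr \<eta>"
  have r: "0 \<le> r" "r < 1" using pos by (auto simp: r_def powr_def ln_div)
  have step: "\<bar>(grid_sum T (N * 2 ^ Suc m) f g t - grid_sum T (N * 2 ^ Suc m) f g s)
        - (grid_sum T (N * 2 ^ m) f g t - grid_sum T (N * 2 ^ m) f g s)\<bar>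
       \<le> (K * (T / real N) powr \<eta> * (t - s + T / real N) powr \<beta>) * r ^ m"
    if N: "N \<ge> 1" and st: "0 \<le> s" "s \<le> t" "t \<le> T" for N s t m
  proof -
    let ?h = "T / real N" and ?h' = "T / real (N * 2 ^ m)"
    have h': "?h' = ?h * (1/2) ^ m" by (simp add: power_one_over field_simps)
    have h: "0 \<le> ?h" using T by simp
    have le: "?h' \<le> ?h" unfolding h' using h by (intro mult_left_le) (auto simp: power_le_one)
    have "?h' powr \<eta> = ?h powr \<eta> * ((1/2) ^ m) powr \<eta>"
      unfolding h' by (rule powr_mult)
    also have "((1/2::real) ^ m) powr \<eta> = ((1/2) powr real m) powr \<eta>"
      by (simp add: powr_realpow)
    also have "\<dots> = (1/2) powr (real m * \<eta>)" by (rule powr_powr)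
    also have "\<dots> = r ^ m" by (simp add: r_def powr_power)
    finally have p: "?h' powr \<eta> = ?h powr \<eta> * r ^ m" .
    have "\<bar>(grid_sum T (N * 2 ^ m * 2) f g t - grid_sum T (N * 2 ^ m) f g t)
        - (grid_sum T (N * 2 ^ m * 2) f g s - grid_sum T (N * 2 ^ m) f g s)\<bar>
       \<le> K * ?h' powr \<eta> * (t - s + ?h') powr \<beta>"
      using N st by (intro Kb) auto
    also have "\<dots> \<le> K * ?h' powr \<eta> * (t - s + ?h) powr \<beta>"
      using K st le T pos by (intro mult_left_mono powr_mono2) auto
    also have "\<dots> = (K * ?h powr \<eta> * (t - s + ?h) powr \<beta>) * r ^ m"
      unfolding p by simp
    finally show ?thesis by (simp add: algebra_simps)
  qed
  have conv: "(\<lambda>m. grid_sum T (N * 2 ^ m) f g t) \<longlonglongrightarrow> integral_limit N t"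
    if N: "N \<ge> 1" and t: "0 \<le> t" "t \<le> T" for N t
  proof -
    have "convergent (\<lambda>m. grid_sum T (N * 2 ^ m) f g t)"
      using step[OF N order.refl t] r T by (intro geometric_steps_convergent[of _ _ r]) auto
    then show ?thesis unfolding integral_limit_def by (simp add: convergent_LIMSEQ_iff)
  qed
  have "\<bar>(integral_limit N t - grid_sum T N f g t) - (integral_limit N s - grid_sum T N f g s)\<bar>
       \<le> K / (1 - r) * (T / real N) powr \<eta> * (t - s + T / real N) powr \<beta>"
    if N: "N \<ge> 1" and st: "0 \<le> s" "s \<le> t" "t \<le> T" for N s t
  proof -
    have "(\<lambda>m. grid_sum T (N * 2 ^ m) f g t - grid_sum T (N * 2 ^ m) f g s)
        \<longlonglongrightarrow> integral_limit N t - integral_limit N s"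
      using N st by (intro tendsto_diff conv) auto
    from geometric_steps_limit[OF step[OF N st] r _ this] K
    show ?thesis by (simp add: algebra_simps)
  qed
  moreover have "K / (1 - r) \<ge> 0" using K r by simp
  ultimately show ?thesis using conv by (intro exI[of _ "K / (1 - r)"]) auto
qed

text \<open>The grid with \<open>N * 2\<^sup>m\<close> cells refines the one with \<open>2\<^sup>m\<close> cells by the fixed factor \<open>N\<close>, so the bound
  for \<open>q = N\<close> forces the difference of the two Riemann sums to vanish as \<open>m\<close> grows.\<close>

lemma integral_limit_unique:
  assumes N: "N \<ge> 1" and t: "0 \<le> t" "t \<le> T"
  shows "integral_limit N t = integral_limit 1 t"
proof -
  obtain K where "K \<ge> 0" and K: "\<And>M s t. M \<ge> 1 \<Longrightarrow> 0 \<le> s \<Longrightarrow> s \<le> t \<Longrightarrow> t \<le> T \<Longrightarrow>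
     \<bar>(grid_sum T (M * N) f g t - grid_sum T M f g t) - (grid_sum T (M * N) f g s - grid_sum T M f g s)\<bar>
       \<le> K * (T / real M) powr \<eta> * (t - s + T / real M) powr \<beta>"
    using refine_increment[OF N] by blast
  have conv: "(\<lambda>m. grid_sum T (M * 2 ^ m) f g t) \<longlonglongrightarrow> integral_limit M t" if "M \<ge> 1" for M
    using grid_sum_to_limit that t by blast
  have "(\<lambda>m. grid_sum T (N * 2 ^ m) f g t - grid_sum T (1 * 2 ^ m) f g t) \<longlonglongrightarrow> 0"
  proof (rule Lim_null_comparison)
    show "\<forall>\<^sub>F m in sequentially. norm (grid_sum T (N * 2 ^ m) f g t - grid_sum T (1 * 2 ^ m) f g t)
       \<le> K * (T / 2 ^ m) powr \<eta> * (t + T / 2 ^ m) powr \<beta>"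
      using K[of "2 ^ _" 0 t] t T by (intro always_eventually allI) (simp add: mult.commute[of N])
    have "(\<lambda>m. T / 2 ^ m) \<longlonglongrightarrow> 0" using LIMSEQ_divide_realpow_zero[of 2 T] by simp
    moreover from this have "(\<lambda>m. (t + T / 2 ^ m) powr \<beta>) \<longlonglongrightarrow> (t + 0) powr \<beta>"
      using pos t T by (intro tendsto_powr2 tendsto_intros) auto
    moreover have "(\<lambda>m. (T / 2 ^ m) powr \<eta>) \<longlonglongrightarrow> 0"
      using calculation(1) pos T by (intro tendsto_zero_powrI[OF _ tendsto_const]) auto
    ultimately have "(\<lambda>m. K * (T / 2 ^ m) powr \<eta> * (t + T / 2 ^ m) powr \<beta>) \<longlonglongrightarrow> K * 0 * (t + 0) powr \<beta>"
      by (intro tendsto_mult tendsto_const)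
    then show "(\<lambda>m. K * (T / 2 ^ m) powr \<eta> * (t + T / 2 ^ m) powr \<beta>) \<longlonglongrightarrow> 0" by simp
  qed
  moreover have "(\<lambda>m. grid_sum T (N * 2 ^ m) f g t - grid_sum T (1 * 2 ^ m) f g t)
      \<longlonglongrightarrow> integral_limit N t - integral_limit 1 t"
    using N by (intro tendsto_diff conv) auto
  ultimately have "integral_limit N t - integral_limit 1 t = 0" by (rule LIMSEQ_unique[rotated])
  then show ?thesis by simp
qed

abbreviation "J \<equiv> integral_limit 1"

lemma grid_sum_error:
  obtains K where "K \<ge> 0" "\<And>N s t. N \<ge> 1 \<Longrightarrow> 0 \<le> s \<Longrightarrow> s \<le> t \<Longrightarrow> t \<le> T \<Longrightarrow>
     \<bar>(J t - grid_sum T N f g t) - (J s - grid_sum T N f g s)\<bar>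
       \<le> K * (T / real N) powr \<eta> * (t - s + T / real N) powr \<beta>"
proof -
  obtain K where K: "K \<ge> 0" "\<And>N s t. N \<ge> 1 \<Longrightarrow> 0 \<le> s \<Longrightarrow> s \<le> t \<Longrightarrow> t \<le> T \<Longrightarrow>
     \<bar>(integral_limit N t - grid_sum T N f g t) - (integral_limit N s - grid_sum T N f g s)\<bar>
       \<le> K * (T / real N) powr \<eta> * (t - s + T / real N) powr \<beta>"
    using grid_sum_to_limit by blast
  show ?thesis
  proof (rule that[OF K(1)])
    fix N s t assume *: "(N::nat) \<ge> 1" "0 \<le> s" "s \<le> t" "t \<le> T"
    show "\<bar>(J t - grid_sum T N f g t) - (J s - grid_sum T N f g s)\<bar>
       \<le> K * (T / real N) powr \<eta> * (t - s + T / real N) powr \<beta>"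
      using K(2)[OF *] integral_limit_unique[OF *(1), of t] integral_limit_unique[OF *(1), of s] * by simp
  qed
qed

lemma grid_sum_uniform_error:
  obtains K where "K \<ge> 0" "\<And>N t. N \<ge> 1 \<Longrightarrow> 0 \<le> t \<Longrightarrow> t \<le> T \<Longrightarrow>
     \<bar>grid_sum T N f g t - J t\<bar> \<le> K * (T / real N) powr \<eta>"
proof -
  obtain K where K: "K \<ge> 0" "\<And>N s t. N \<ge> 1 \<Longrightarrow> 0 \<le> s \<Longrightarrow> s \<le> t \<Longrightarrow> t \<le> T \<Longrightarrow>
     \<bar>(J t - grid_sum T N f g t) - (J s - grid_sum T N f g s)\<bar>
       \<le> K * (T / real N) powr \<eta> * (t - s + T / real N) powr \<beta>"
    using grid_sum_error by blast
  have J0: "J 0 = 0" using T by (simp add: integral_limit_def)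
  show ?thesis
  proof (rule that[of "K * (2 * T) powr \<beta>"])
    fix N t assume *: "(N::nat) \<ge> 1" "0 \<le> t" "t \<le> T"
    have "\<bar>grid_sum T N f g t - J t\<bar> \<le> K * (T / real N) powr \<eta> * (t + T / real N) powr \<beta>"
      using K(2)[OF *(1) order.refl *(2,3)] T J0 by simp
    also have "\<dots> \<le> K * (T / real N) powr \<eta> * (2 * T) powr \<beta>"
    proof (intro mult_left_mono powr_mono2)
      have "T / real N \<le> T" using * T by (simp add: field_simps)
      then show "t + T / real N \<le> 2 * T" using * by simp
    qed (use K pos * T in auto)
    finally show "\<bar>grid_sum T N f g t - J t\<bar> \<le> K * (2 * T) powr \<beta> * (T / real N) powr \<eta>"
      by (simp add: ac_simps)
  qed (use K in simp)
qed

text \<open>An interval no longer than a cell meets at most two cells, so that the compensated increment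
  consists of at most two products of small increments.\<close>

lemma grid_sum_short_interval:
  obtains K where "K \<ge> 0" "\<And>N s t. N \<ge> 1 \<Longrightarrow> 0 \<le> s \<Longrightarrow> s \<le> t \<Longrightarrow> t \<le> T \<Longrightarrow> t - s \<le> T / real N \<Longrightarrow>
     \<bar>grid_sum T N f g t - grid_sum T N f g s - f s * (g t - g s)\<bar> \<le> K * (T / real N) powr (2 * \<alpha>)"
proof -
  obtain C where C: "C \<ge> 0" "\<And>s t. 0 \<le> s \<Longrightarrow> s \<le> t \<Longrightarrow> t \<le> T \<Longrightarrow> \<bar>f t - f s\<bar> \<le> C * (t - s) powr \<alpha>"
    using holder_on_D[OF f] by blast
  obtain D where D: "D \<ge> 0" "\<And>s t. 0 \<le> s \<Longrightarrow> s \<le> t \<Longrightarrow> t \<le> T \<Longrightarrow> \<bar>g t - g s\<bar> \<le> D * (t - s) powr \<alpha>"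
    using holder_on_D[OF g] by blast
  show ?thesis
  proof (rule that[of "2 * (C * D)"])
    fix N s t assume N: "(N::nat) \<ge> 1" and st: "0 \<le> s" "s \<le> t" "t \<le> T" "t - s \<le> T / real N"
    let ?h = "T / real N"
    have h: "0 < ?h" using T N by simp
    have prod: "\<bar>(f x - f y) * (g v - g w)\<bar> \<le> C * D * ?h powr (2 * \<alpha>)"
      if "0 \<le> x" "x \<le> T" "0 \<le> y" "y \<le> T" "\<bar>x - y\<bar> \<le> ?h" "0 \<le> w" "w \<le> v" "v \<le> T" "v - w \<le> ?h" for x y v w
    proof -
      have "\<bar>f x - f y\<bar> \<le> C * \<bar>x - y\<bar> powr \<alpha>"
        using C(2)[of x y] C(2)[of y x] that by (cases "x \<le> y") (auto simp: abs_minus_commute)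
      also have "\<dots> \<le> C * ?h powr \<alpha>" using that C pos by (intro mult_left_mono powr_mono2) auto
      finally have 1: "\<bar>f x - f y\<bar> \<le> C * ?h powr \<alpha>" .
      have "\<bar>g v - g w\<bar> \<le> D * (v - w) powr \<alpha>" using that by (intro D) auto
      also have "\<dots> \<le> D * ?h powr \<alpha>" using that D pos by (intro mult_left_mono powr_mono2) auto
      finally have "\<bar>g v - g w\<bar> \<le> D * ?h powr \<alpha>" .
      then have "\<bar>f x - f y\<bar> * \<bar>g v - g w\<bar> \<le> (C * ?h powr \<alpha>) * (D * ?h powr \<alpha>)"
        using 1 C by (intro mult_mono) auto
      also have "\<dots> = C * D * ?h powr (2 * \<alpha>)"
        using powr_add[of ?h \<alpha> \<alpha>] by simp
      finally show ?thesis by (simp add: abs_mult)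
    qed
    obtain k where k: "k < N" "grid T N k \<le> s" "s \<le> grid T N (Suc k)"
      using grid_cell[OF T N, of s] st by auto
    let ?a = "grid T N k" and ?b = "grid T N (Suc k)" and ?S = "grid_sum T N f g"
    have bT: "0 \<le> ?a" "?b \<le> T" using T k by (auto intro!: grid_nonneg grid_le)
    have b: "?b = ?a + ?h" by (rule grid_Suc)
    have Ss: "?S s = ?S ?a + f ?a * (g s - g ?a)" using grid_sum_cell[OF T k] .
    show "\<bar>?S t - ?S s - f s * (g t - g s)\<bar> \<le> 2 * (C * D) * ?h powr (2 * \<alpha>)"
    proof (cases "t \<le> ?b")
      case True
      then have "?S t = ?S ?a + f ?a * (g t - g ?a)" using k st by (intro grid_sum_cell T) auto
      then have "?S t - ?S s - f s * (g t - g s) = (f ?a - f s) * (g t - g s)"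
        using Ss by (simp add: algebra_simps)
      moreover have "\<bar>(f ?a - f s) * (g t - g s)\<bar> \<le> C * D * ?h powr (2 * \<alpha>)"
        by (rule prod) (use st k b bT in linarith)+
      ultimately have "\<bar>?S t - ?S s - f s * (g t - g s)\<bar> \<le> C * D * ?h powr (2 * \<alpha>)" by simp
      also have "\<dots> \<le> 2 * (C * D) * ?h powr (2 * \<alpha>)" using C D by (intro mult_right_mono) auto
      finally show ?thesis .
    next
      case False
      then have "?b < T" using st by simp
      then have "Suc k < N" using k by (cases "Suc k = N") (use N in auto)
      moreover have "t \<le> grid T N (Suc (Suc k))" using st k grid_Suc[of T N "Suc k"] by simp
      ultimately have "?S t = ?S ?b + f ?b * (g t - g ?b)"
        using False by (intro grid_sum_cell T) auto
      moreover have "?S ?b = ?S ?a + f ?a * (g ?b - g ?a)" using k b h by (intro grid_sum_cell T) auto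
      ultimately have "?S t - ?S s - f s * (g t - g s) = (f ?a - f s) * (g ?b - g s) + (f ?b - f s) * (g t - g ?b)"
        using Ss by (simp add: algebra_simps)
      moreover have "\<bar>(f ?a - f s) * (g ?b - g s)\<bar> \<le> C * D * ?h powr (2 * \<alpha>)"
        by (rule prod) (use st k b bT False in linarith)+
      moreover have "\<bar>(f ?b - f s) * (g t - g ?b)\<bar> \<le> C * D * ?h powr (2 * \<alpha>)"
        by (rule prod) (use st k b bT False in linarith)+
      ultimately show ?thesis by linarith
    qed
  qed (use C D in simp)
qed

text \<open>Both errors, that of replacing \<open>J\<close> by a Riemann sum and that of the Riemann sum on a short interval,
  have the right order at once if the cell length is comparable to \<open>t - s\<close>.\<close>

lemma limit_area_bound:
  obtains K where "K \<ge> 0" "\<And>s t. 0 \<le> s \<Longrightarrow> s \<le> t \<Longrightarrow> t \<le> T \<Longrightarrow>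
     \<bar>J t - J s - f s * (g t - g s)\<bar> \<le> K * (t - s) powr \<beta>"
proof -
  obtain K where K: "K \<ge> 0" "\<And>N s t. N \<ge> 1 \<Longrightarrow> 0 \<le> s \<Longrightarrow> s \<le> t \<Longrightarrow> t \<le> T \<Longrightarrow>
     \<bar>(J t - grid_sum T N f g t) - (J s - grid_sum T N f g s)\<bar>
       \<le> K * (T / real N) powr \<eta> * (t - s + T / real N) powr \<beta>"
    using grid_sum_error by blast
  obtain S where S: "S \<ge> 0" "\<And>N s t. N \<ge> 1 \<Longrightarrow> 0 \<le> s \<Longrightarrow> s \<le> t \<Longrightarrow> t \<le> T \<Longrightarrow> t - s \<le> T / real N \<Longrightarrow>
     \<bar>grid_sum T N f g t - grid_sum T N f g s - f s * (g t - g s)\<bar> \<le> S * (T / real N) powr (2 * \<alpha>)"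
    using grid_sum_short_interval by blast
  let ?K = "K * T powr \<eta> * 3 powr \<beta> + S * 2 powr \<beta> * T powr \<eta>"
  show ?thesis
  proof (rule that[of ?K])
    fix s t assume st: "0 \<le> s" "s \<le> t" "t \<le> T"
    show "\<bar>J t - J s - f s * (g t - g s)\<bar> \<le> ?K * (t - s) powr \<beta>"
    proof (cases "s = t")
      case False
      define L where "L = t - s"
      have L: "0 < L" "L \<le> T" using st False by (auto simp: L_def)
      \<comment> \<open>the grid whose mesh \<open>h\<close> satisfies \<open>L \<le> h \<le> 2 * L\<close>\<close>
      define N where "N = nat \<lfloor>T / L\<rfloor>"
      have "1 \<le> T / L" using L by simp
      then have N: "N \<ge> 1" "real N \<le> T / L" "T / L < real N + 1"
        unfolding N_def by (simp_all add: of_nat_nat le_nat_iff)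
      define h where "h = T / real N"
      have h: "L \<le> h" "h \<le> 2 * L" "h \<le> T"
      proof -
        show "L \<le> h" using N L T by (simp add: h_def field_simps)
        have "T / L \<le> 2 * real N" using N by linarith
        then show "h \<le> 2 * L" using N L T by (simp add: h_def field_simps)
        show "h \<le> T" using N T by (simp add: h_def field_simps)
      qed
      have "\<bar>J t - J s - f s * (g t - g s)\<bar> \<le> K * h powr \<eta> * (L + h) powr \<beta> + S * h powr (2 * \<alpha>)"
        using K(2)[OF N(1) st] S(2)[OF N(1) st] h(1) unfolding L_def h_def by linarith
      also have "h powr (2 * \<alpha>) = h powr \<beta> * h powr \<eta>" unfolding expo by (rule powr_add)
      also have "K * h powr \<eta> * (L + h) powr \<beta> + S * (h powr \<beta> * h powr \<eta>)
          \<le> K * T powr \<eta> * (3 * L) powr \<beta> + S * ((2 * L) powr \<beta> * T powr \<eta>)"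
        using K(1) S(1) h L pos by (intro add_mono mult_mono powr_mono2 mult_nonneg_nonneg) auto
      also have "\<dots> = ?K * L powr \<beta>"
        using powr_mult[of 3 L \<beta>] powr_mult[of 2 L \<beta>] L by (simp add: algebra_simps)
      finally show ?thesis by (simp add: L_def)
    qed simp
  qed (use K S in simp)
qed

lemma grid_area_bound:
  obtains K where "K \<ge> 0" "\<And>N k l. k < l \<Longrightarrow> l \<le> N \<Longrightarrow>
     \<bar>grid_sum T N f g (grid T N l) - grid_sum T N f g (grid T N k)
       - f (grid T N k) * (g (grid T N l) - g (grid T N k))\<bar> \<le> K * (grid T N l - grid T N k) powr \<beta>"
proof -
  obtain K where K: "K \<ge> 0" "\<And>N s t. N \<ge> 1 \<Longrightarrow> 0 \<le> s \<Longrightarrow> s \<le> t \<Longrightarrow> t \<le> T \<Longrightarrow>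
     \<bar>(J t - grid_sum T N f g t) - (J s - grid_sum T N f g s)\<bar>
       \<le> K * (T / real N) powr \<eta> * (t - s + T / real N) powr \<beta>"
    using grid_sum_error by blast
  obtain A where A: "A \<ge> 0" "\<And>s t. 0 \<le> s \<Longrightarrow> s \<le> t \<Longrightarrow> t \<le> T \<Longrightarrow>
     \<bar>J t - J s - f s * (g t - g s)\<bar> \<le> A * (t - s) powr \<beta>"
    using limit_area_bound by blast
  show ?thesis
  proof (rule that[of "A + K * T powr \<eta> * 2 powr \<beta>"])
    fix N k l :: nat assume kl: "k < l" "l \<le> N"
    let ?s = "grid T N k" and ?t = "grid T N l" and ?h = "T / real N"
    have N: "N \<ge> 1" using kl by simp
    have st: "0 \<le> ?s" "?s \<le> ?t" "?t \<le> T" using T kl by (auto intro!: grid_nonneg grid_le grid_mono)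
    have h: "0 < ?h" "?h \<le> T" using N T by (auto simp: field_simps)
    have L: "?h \<le> ?t - ?s"
      using mult_right_mono[of 1 "real (l - k)" ?h] kl h by (simp add: grid_diff)
    have "K * ?h powr \<eta> * (?t - ?s + ?h) powr \<beta> \<le> K * T powr \<eta> * (2 * (?t - ?s)) powr \<beta>"
      using K h L st pos by (intro mult_mono powr_mono2 mult_nonneg_nonneg) auto
    also have "\<dots> = K * T powr \<eta> * 2 powr \<beta> * (?t - ?s) powr \<beta>"
      using powr_mult[of 2 "?t - ?s" \<beta>] st by simp
    finally show "\<bar>grid_sum T N f g ?t - grid_sum T N f g ?s - f ?s * (g ?t - g ?s)\<bar>
        \<le> (A + K * T powr \<eta> * 2 powr \<beta>) * (?t - ?s) powr \<beta>"
      using K(2)[OF N st] A(2)[OF st] unfolding distrib_right by linarith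
  qed (use A K in simp)
qed

end

section \<open>Exponential moments and almost sure bounds\<close>

lemma summable_polynomial_exp:
  fixes c \<gamma> :: real
  assumes "c > 0" "\<gamma> > 0"
  shows "summable (\<lambda>n. real n ^ 2 * exp (- (c * real n powr \<gamma>)))"
proof (rule summable_comparison_test_ev)
  have "((\<lambda>x::real. x ^ 4 * exp (- (c * x powr \<gamma>))) \<longlongrightarrow> 0) at_top"
    using assms by real_asymp
  then have "(\<lambda>n. real n ^ 4 * exp (- (c * real n powr \<gamma>))) \<longlonglongrightarrow> 0"
    by (rule filterlim_compose[OF _ filterlim_real_sequentially])
  then have "\<forall>\<^sub>F n in sequentially. real n ^ 4 * exp (- (c * real n powr \<gamma>)) < 1"
    by (rule order_tendstoD) simp
  then show "\<forall>\<^sub>F n in sequentially. norm (real n ^ 2 * exp (- (c * real n powr \<gamma>))) \<le> 1 / real n ^ 2"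
    using eventually_gt_at_top[of 0]
    by eventually_elim (simp add: field_simps power_add[symmetric])
  show "summable (\<lambda>n. 1 / real n ^ 2)"
    using inverse_power_summable[of 2, where ?'a = real] by (simp add: inverse_eq_divide)
qed

context prob_space
begin

text \<open>Chernoff's bound with the fixed parameter \<open>1 / \<sigma>\<close>.\<close>

lemma exponential_tail:
  assumes [measurable]: "random_variable borel Z" and \<sigma>: "\<sigma> > 0" and C: "C \<ge> 0"
    and mgf: "(\<integral>\<^sup>+\<omega>. ennreal (exp (Z \<omega> / \<sigma>)) \<partial>M) \<le> ennreal C"
      "(\<integral>\<^sup>+\<omega>. ennreal (exp (- Z \<omega> / \<sigma>)) \<partial>M) \<le> ennreal C"
  shows "prob {\<omega>\<in>space M. b < \<bar>Z \<omega>\<bar>} \<le> 2 * C * exp (- (b / \<sigma>))"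
proof -
  have one: "prob {\<omega>\<in>space M. b \<le> Y \<omega>} \<le> C * exp (- (b / \<sigma>))"
    if [measurable]: "random_variable borel Y" and Y: "(\<integral>\<^sup>+\<omega>. ennreal (exp (Y \<omega> / \<sigma>)) \<partial>M) \<le> ennreal C" for Y
  proof -
    have "emeasure M {\<omega>\<in>space M. b \<le> Y \<omega>} \<le> ennreal (exp (- (1 / \<sigma>) * b)) *
        (\<integral>\<^sup>+\<omega>. ennreal (exp (1 / \<sigma> * Y \<omega>)) * indicator (space M) \<omega> \<partial>M)"
      using \<sigma> by (intro Chernoff_ineq_nn_integral_ge) auto
    also have "(\<integral>\<^sup>+\<omega>. ennreal (exp (1 / \<sigma> * Y \<omega>)) * indicator (space M) \<omega> \<partial>M) =
        (\<integral>\<^sup>+\<omega>. ennreal (exp (Y \<omega> / \<sigma>)) \<partial>M)"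
      by (intro nn_integral_cong) simp
    also have "ennreal (exp (- (1 / \<sigma>) * b)) * \<dots> \<le> ennreal (exp (- (1 / \<sigma>) * b)) * ennreal C"
      by (intro mult_left_mono Y) simp
    also have "\<dots> = ennreal (C * exp (- (b / \<sigma>)))"
      using C by (simp add: ennreal_mult[symmetric] mult.commute)
    finally show ?thesis
      using C by (simp add: emeasure_eq_measure)
  qed
  have "prob {\<omega>\<in>space M. b < \<bar>Z \<omega>\<bar>} \<le> prob ({\<omega>\<in>space M. b \<le> Z \<omega>} \<union> {\<omega>\<in>space M. b \<le> - Z \<omega>})"
    by (intro finite_measure_mono) auto
  also have "\<dots> \<le> prob {\<omega>\<in>space M. b \<le> Z \<omega>} + prob {\<omega>\<in>space M. b \<le> - Z \<omega>}"
    by (intro measure_Un_le) auto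
  finally show ?thesis using one[of Z] one[of "\<lambda>\<omega>. - Z \<omega>"] mgf by simp
qed

text \<open>The Borel-Cantelli argument behind all almost sure estimates: each grid carries at most \<open>N\<^sup>2\<close>
  variables, and the probability that one of them exceeds its bound decays faster than any power of
  \<open>N\<close>.\<close>

lemma AE_bound_from_exponential_moments:
  fixes Z :: "nat \<Rightarrow> 'i \<Rightarrow> 'a \<Rightarrow> real" and b \<sigma> :: "nat \<Rightarrow> 'i \<Rightarrow> real"
  assumes fin: "\<And>N. finite (I N)" and card: "\<And>N. card (I N) \<le> N ^ 2"
    and rv: "\<And>N i. N \<ge> 1 \<Longrightarrow> i \<in> I N \<Longrightarrow> random_variable borel (Z N i)"
    and \<sigma>: "\<And>N i. N \<ge> 1 \<Longrightarrow> i \<in> I N \<Longrightarrow> \<sigma> N i > 0" and b: "\<And>N i. N \<ge> 1 \<Longrightarrow> i \<in> I N \<Longrightarrow> b N i > 0"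
    and C: "C \<ge> 0"
    and mgf: "\<And>N i. N \<ge> 1 \<Longrightarrow> i \<in> I N \<Longrightarrow> (\<integral>\<^sup>+\<omega>. ennreal (exp (Z N i \<omega> / \<sigma> N i)) \<partial>M) \<le> ennreal C"
      "\<And>N i. N \<ge> 1 \<Longrightarrow> i \<in> I N \<Longrightarrow> (\<integral>\<^sup>+\<omega>. ennreal (exp (- Z N i \<omega> / \<sigma> N i)) \<partial>M) \<le> ennreal C"
    and rate: "\<And>N i. N \<ge> 1 \<Longrightarrow> i \<in> I N \<Longrightarrow> c * real N powr \<gamma> \<le> b N i / \<sigma> N i"
    and c: "c > 0" "\<gamma> > 0"
  shows "AE \<omega> in M. \<exists>K\<ge>0. \<forall>N\<ge>1. \<forall>i\<in>I N. \<bar>Z N i \<omega>\<bar> \<le> K * b N i"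
proof -
  define A where "A = (\<lambda>N. if N = 0 then {} else (\<Union>i\<in>I N. {\<omega>\<in>space M. b N i < \<bar>Z N i \<omega>\<bar>}))"
  have meas: "{\<omega>\<in>space M. b N i < \<bar>Z N i \<omega>\<bar>} \<in> events" if "N \<ge> 1" "i \<in> I N" for N i
    using rv[OF that] by measurable
  have A [measurable]: "A N \<in> events" for N
    using meas fin by (auto simp: A_def intro!: sets.finite_UN)
  have pA: "prob (A N) \<le> 2 * C * (real N ^ 2 * exp (- (c * real N powr \<gamma>)))" for N
  proof (cases "N = 0")
    case False
    then have N: "N \<ge> 1" by simp
    have "prob (A N) \<le> (\<Sum>i\<in>I N. prob {\<omega>\<in>space M. b N i < \<bar>Z N i \<omega>\<bar>})"
      using False meas[OF N] fin by (auto simp: A_def intro!: finite_measure_subadditive_finite)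
    also have "\<dots> \<le> (\<Sum>i\<in>I N. 2 * C * exp (- (c * real N powr \<gamma>)))"
    proof (rule sum_mono)
      fix i assume i: "i \<in> I N"
      have "prob {\<omega>\<in>space M. b N i < \<bar>Z N i \<omega>\<bar>} \<le> 2 * C * exp (- (b N i / \<sigma> N i))"
        using N i by (intro exponential_tail rv \<sigma> C mgf) auto
      also have "\<dots> \<le> 2 * C * exp (- (c * real N powr \<gamma>))"
        using rate[OF N i] C by (intro mult_left_mono) auto
      finally show "prob {\<omega>\<in>space M. b N i < \<bar>Z N i \<omega>\<bar>} \<le> 2 * C * exp (- (c * real N powr \<gamma>))" .
    qed
    also have "\<dots> = real (card (I N)) * (2 * C * exp (- (c * real N powr \<gamma>)))" by simp
    also have "\<dots> \<le> real (N ^ 2) * (2 * C * exp (- (c * real N powr \<gamma>)))"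
      using card[of N] C by (intro mult_right_mono) (auto simp only: of_nat_le_iff mult_nonneg_nonneg exp_ge_zero)
    finally show ?thesis by (simp add: ac_simps)
  qed (simp add: A_def)
  have "summable (\<lambda>N. prob (A N))"
    using pA by (intro summable_comparison_test'[OF summable_mult[OF summable_polynomial_exp[OF c]]]) auto
  then have "AE \<omega> in M. \<forall>\<^sub>F N in sequentially. \<omega> \<in> space M - A N"
    by (intro borel_cantelli_AE1) (auto simp: emeasure_eq_measure)
  then show ?thesis
  proof (eventually_elim)
    case (elim \<omega>)
    then obtain N0 where N0: "\<And>N. N \<ge> N0 \<Longrightarrow> \<omega> \<in> space M - A N"
      by (auto simp: eventually_sequentially)
    \<comment> \<open>finitely many exceptional grids are absorbed into the constant\<close>
    define K where "K = 1 + (\<Sum>N\<in>{1..<N0}. \<Sum>i\<in>I N. \<bar>Z N i \<omega>\<bar> / b N i)"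
    have nn: "0 \<le> \<bar>Z N i \<omega>\<bar> / b N i" if "N \<ge> 1" "i \<in> I N" for N i
      using b[OF that] by simp
    have K1: "K \<ge> 1" unfolding K_def by (auto intro!: sum_nonneg nn)
    have "\<bar>Z N i \<omega>\<bar> \<le> K * b N i" if N: "N \<ge> 1" and i: "i \<in> I N" for N i
    proof (cases "N < N0")
      case True
      have "\<bar>Z N i \<omega>\<bar> / b N i \<le> (\<Sum>i\<in>I N. \<bar>Z N i \<omega>\<bar> / b N i)"
        using fin i N by (intro member_le_sum nn) auto
      also have "\<dots> \<le> (\<Sum>N\<in>{1..<N0}. \<Sum>i\<in>I N. \<bar>Z N i \<omega>\<bar> / b N i)"
        using N True by (intro member_le_sum[of N "{1..<N0}" "\<lambda>N. \<Sum>i\<in>I N. \<bar>Z N i \<omega>\<bar> / b N i"] sum_nonneg nn) auto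
      also have "\<dots> \<le> K" by (simp add: K_def)
      finally show ?thesis using b[OF N i] by (simp add: field_simps)
    next
      case False
      then have "\<bar>Z N i \<omega>\<bar> \<le> b N i" using N0[of N] N i by (auto simp: A_def not_less)
      also have "\<dots> \<le> K * b N i" using K1 b[OF N i] by simp
      finally show ?thesis .
    qed
    then show ?case using K1 by (intro exI[of _ K]) auto
  qed
qed

end

text \<open>Completing the square turns the tilted density into a shifted normal density.\<close>

lemma nn_integral_exp_linear_normal:
  assumes "\<sigma> > 0"
  shows "(\<integral>\<^sup>+x. ennreal (normal_density 0 \<sigma> x) * ennreal (exp (c * x)) \<partial>lborel) = ennreal (exp (c\<^sup>2 * \<sigma>\<^sup>2 / 2))"
proof -
  have "normal_density 0 \<sigma> x * exp (c * x) = exp (c\<^sup>2 * \<sigma>\<^sup>2 / 2) * normal_density (c * \<sigma>\<^sup>2) \<sigma> x" for x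
  proof -
    have "- x\<^sup>2 / (2 * \<sigma>\<^sup>2) + c * x = c\<^sup>2 * \<sigma>\<^sup>2 / 2 + - (x - c * \<sigma>\<^sup>2)\<^sup>2 / (2 * \<sigma>\<^sup>2)"
      using assms by (simp add: field_simps power2_eq_square)
    then have "exp (- x\<^sup>2 / (2 * \<sigma>\<^sup>2)) * exp (c * x) = exp (c\<^sup>2 * \<sigma>\<^sup>2 / 2) * exp (- (x - c * \<sigma>\<^sup>2)\<^sup>2 / (2 * \<sigma>\<^sup>2))"
      unfolding exp_add[symmetric] by (rule arg_cong)
    then show ?thesis by (simp add: normal_density_def)
  qed
  then have "(\<integral>\<^sup>+x. ennreal (normal_density 0 \<sigma> x) * ennreal (exp (c * x)) \<partial>lborel) =
     (\<integral>\<^sup>+x. ennreal (exp (c\<^sup>2 * \<sigma>\<^sup>2 / 2)) * ennreal (normal_density (c * \<sigma>\<^sup>2) \<sigma> x) \<partial>lborel)"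
    by (simp add: ennreal_mult[symmetric])
  also have "\<dots> = ennreal (exp (c\<^sup>2 * \<sigma>\<^sup>2 / 2)) * (\<integral>\<^sup>+x. ennreal (normal_density (c * \<sigma>\<^sup>2) \<sigma> x) \<partial>lborel)"
    by (rule nn_integral_cmult) simp
  also have "(\<integral>\<^sup>+x. ennreal (normal_density (c * \<sigma>\<^sup>2) \<sigma> x) \<partial>lborel) = 1"
    using assms by (simp add: nn_integral_eq_integral)
  finally show ?thesis by simp
qed

text \<open>The integrand is a multiple of the normal density of standard deviation \<open>\<sigma> / sqrt (1 - z)\<close>, where
  \<open>z = 2 * c * \<sigma>\<^sup>2\<close>; the integral is \<open>1 / sqrt (1 - z)\<close>, which is at most \<open>exp z\<close> for \<open>z \<le> 1 / 2\<close>.\<close>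

lemma nn_integral_exp_square_normal:
  assumes \<sigma>: "\<sigma> > 0" and c: "0 \<le> c" "2 * c * \<sigma>\<^sup>2 \<le> 1/2"
  shows "(\<integral>\<^sup>+x. ennreal (normal_density 0 \<sigma> x) * ennreal (exp (c * x\<^sup>2)) \<partial>lborel) \<le> ennreal (exp (2 * c * \<sigma>\<^sup>2))"
proof -
  define z where "z = 2 * c * \<sigma>\<^sup>2"
  have z: "0 \<le> z" "z \<le> 1/2" using c by (auto simp: z_def)
  define \<tau> where "\<tau> = \<sigma> / sqrt (1 - z)"
  have \<tau>: "\<tau> > 0" "\<tau>\<^sup>2 = \<sigma>\<^sup>2 / (1 - z)" using \<sigma> z by (auto simp: \<tau>_def power_divide)
  have "normal_density 0 \<sigma> x * exp (c * x\<^sup>2) = (1 / sqrt (1 - z)) * normal_density 0 \<tau> x" for x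
  proof -
    have "- x\<^sup>2 / (2 * \<sigma>\<^sup>2) + c * x\<^sup>2 = - x\<^sup>2 / (2 * \<tau>\<^sup>2)"
      using \<sigma> z unfolding \<tau>(2) by (simp add: z_def field_simps power2_eq_square)
    then have "exp (- x\<^sup>2 / (2 * \<sigma>\<^sup>2)) * exp (c * x\<^sup>2) = exp (- x\<^sup>2 / (2 * \<tau>\<^sup>2))"
      by (simp add: exp_add[symmetric])
    moreover have "1 / sqrt (2 * pi * \<sigma>\<^sup>2) = (1 / sqrt (1 - z)) * (1 / sqrt (2 * pi * \<tau>\<^sup>2))"
      using \<sigma> z unfolding \<tau>(2) by (simp add: real_sqrt_mult real_sqrt_divide)
    ultimately show ?thesis by (simp add: normal_density_def mult.assoc)
  qed
  then have "(\<integral>\<^sup>+x. ennreal (normal_density 0 \<sigma> x) * ennreal (exp (c * x\<^sup>2)) \<partial>lborel) =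
     (\<integral>\<^sup>+x. ennreal (1 / sqrt (1 - z)) * ennreal (normal_density 0 \<tau> x) \<partial>lborel)"
    using z by (simp add: ennreal_mult[symmetric])
  also have "\<dots> = ennreal (1 / sqrt (1 - z)) * (\<integral>\<^sup>+x. ennreal (normal_density 0 \<tau> x) \<partial>lborel)"
    by (rule nn_integral_cmult) simp
  also have "(\<integral>\<^sup>+x. ennreal (normal_density 0 \<tau> x) \<partial>lborel) = 1"
    using \<tau> by (simp add: nn_integral_eq_integral)
  also have "1 / sqrt (1 - z) \<le> exp z"
  proof -
    have "1 \<le> (1 + 2 * z) * (1 - z)"
    proof -
      have "0 \<le> z * (1 - 2 * z)" using z by (intro mult_nonneg_nonneg) auto
      then show ?thesis by (simp add: algebra_simps)
    qed
    also have "\<dots> \<le> exp (2 * z) * (1 - z)"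
      using z exp_ge_add_one_self[of "2 * z"] by (intro mult_right_mono) auto
    also have "\<dots> = (exp z * sqrt (1 - z))\<^sup>2"
      using z by (simp add: power_mult_distrib exp_double)
    finally have "1 \<le> exp z * sqrt (1 - z)"
      using z by (intro power2_le_imp_le[of 1]) auto
    then show ?thesis using z by (simp add: field_simps)
  qed
  finally show ?thesis by (simp add: z_def ennreal_leI)
qed

context prob_space
begin

lemma exp_moment_normal:
  assumes D: "distributed M lborel X (\<lambda>x. ennreal (normal_density 0 \<sigma> x))" and \<sigma>: "\<sigma> > 0"
  shows "(\<integral>\<^sup>+\<omega>. ennreal (exp (c * X \<omega>)) \<partial>M) = ennreal (exp (c\<^sup>2 * \<sigma>\<^sup>2 / 2))"
proof -
  have "(\<integral>\<^sup>+x. ennreal (normal_density 0 \<sigma> x) * ennreal (exp (c * x)) \<partial>lborel) = (\<integral>\<^sup>+\<omega>. ennreal (exp (c * X \<omega>)) \<partial>M)"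
    by (rule distributed_nn_integral[OF D]) simp
  then show ?thesis using nn_integral_exp_linear_normal[OF \<sigma>, of c] by simp
qed

text \<open>Integrating over \<open>Y\<close> first leaves the exponential of a multiple of \<open>X\<^sup>2\<close>.  There is no term of first
  order in \<open>c\<close>, since the product has mean 0; this is what makes sums of \<open>m\<close> such products grow like
  \<open>sqrt m\<close> only.\<close>

lemma exp_moment_indep_normal_product:
  assumes ind: "indep_var borel X borel Y"
    and X: "distributed M lborel X (\<lambda>x. ennreal (normal_density 0 s x))" and s: "s > 0"
    and Y: "distributed M lborel Y (\<lambda>x. ennreal (normal_density 0 r x))" and r: "r > 0"
    and small: "(c * s * r)\<^sup>2 \<le> 1/2"
  shows "(\<integral>\<^sup>+\<omega>. ennreal (exp (c * (X \<omega> * Y \<omega>))) \<partial>M) \<le> ennreal (exp ((c * s * r)\<^sup>2))"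
proof -
  have rv [measurable]: "random_variable borel X" "random_variable borel Y"
    using ind by (auto dest: indep_var_rv1 indep_var_rv2)
  interpret Y: prob_space "distr M borel Y" by (rule prob_space_distr) simp
  have "(\<integral>\<^sup>+\<omega>. ennreal (exp (c * (X \<omega> * Y \<omega>))) \<partial>M) =
     (\<integral>\<^sup>+z. ennreal (exp (c * (fst z * snd z))) \<partial>distr M (borel \<Otimes>\<^sub>M borel) (\<lambda>\<omega>. (X \<omega>, Y \<omega>)))"
    by (subst nn_integral_distr) auto
  also have "distr M (borel \<Otimes>\<^sub>M borel) (\<lambda>\<omega>. (X \<omega>, Y \<omega>)) = distr M borel X \<Otimes>\<^sub>M distr M borel Y"
    using ind by (simp add: indep_var_distribution_eq)
  also have "(\<integral>\<^sup>+z. ennreal (exp (c * (fst z * snd z))) \<partial>(distr M borel X \<Otimes>\<^sub>M distr M borel Y)) =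
     (\<integral>\<^sup>+x. \<integral>\<^sup>+y. ennreal (exp (c * (x * y))) \<partial>distr M borel Y \<partial>distr M borel X)"
    by (subst Y.nn_integral_fst[symmetric]) auto
  also have "\<dots> = (\<integral>\<^sup>+x. ennreal (exp ((c\<^sup>2 * r\<^sup>2 / 2) * x\<^sup>2)) \<partial>distr M borel X)"
  proof (rule nn_integral_cong)
    fix x :: real
    have "(\<integral>\<^sup>+y. ennreal (exp (c * (x * y))) \<partial>distr M borel Y) = (\<integral>\<^sup>+\<omega>. ennreal (exp ((c * x) * Y \<omega>)) \<partial>M)"
      by (subst nn_integral_distr) (auto simp: mult.assoc)
    also have "\<dots> = ennreal (exp ((c * x)\<^sup>2 * r\<^sup>2 / 2))" by (rule exp_moment_normal[OF Y r])
    finally show "(\<integral>\<^sup>+y. ennreal (exp (c * (x * y))) \<partial>distr M borel Y) = ennreal (exp ((c\<^sup>2 * r\<^sup>2 / 2) * x\<^sup>2))"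
      by (simp add: power_mult_distrib ac_simps)
  qed
  also have "\<dots> = (\<integral>\<^sup>+\<omega>. ennreal (exp ((c\<^sup>2 * r\<^sup>2 / 2) * (X \<omega>)\<^sup>2)) \<partial>M)"
    by (subst nn_integral_distr) auto
  also have "\<dots> = (\<integral>\<^sup>+x. ennreal (normal_density 0 s x) * ennreal (exp ((c\<^sup>2 * r\<^sup>2 / 2) * x\<^sup>2)) \<partial>lborel)"
    by (rule distributed_nn_integral[OF X, symmetric]) simp
  also have "\<dots> \<le> ennreal (exp (2 * (c\<^sup>2 * r\<^sup>2 / 2) * s\<^sup>2))"
    using small by (intro nn_integral_exp_square_normal s) (auto simp: power_mult_distrib ac_simps)
  also have "2 * (c\<^sup>2 * r\<^sup>2 / 2) * s\<^sup>2 = (c * s * r)\<^sup>2" by (simp add: power_mult_distrib)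
  finally show ?thesis .
qed

text \<open>The increment over a cell has standard deviation \<open>h\<^sup>H\<close>, which is smaller than the admitted size
  \<open>h\<^sup>a\<close> by a power of \<open>N\<close>.\<close>

lemma holder_of_gaussian_increments:
  fixes X :: "real \<Rightarrow> 'a \<Rightarrow> real"
  assumes T: "T > 0" and a: "0 < a" "a < H"
    and D: "\<And>s t. 0 \<le> s \<Longrightarrow> s < t \<Longrightarrow> t \<le> T \<Longrightarrow>
      distributed M lborel (\<lambda>\<omega>. X t \<omega> - X s \<omega>) (\<lambda>x. ennreal (normal_density 0 ((t - s) powr H) x))"
    and cont: "AE \<omega> in M. continuous_on {0..T} (\<lambda>t. X t \<omega>)"
  shows "AE \<omega> in M. holder_on T a (\<lambda>t. X t \<omega>)"
proof -
  let ?Z = "\<lambda>N k \<omega>. X (grid T N (Suc k)) \<omega> - X (grid T N k) \<omega>"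
  have D': "distributed M lborel (?Z N k) (\<lambda>x. ennreal (normal_density 0 ((T / real N) powr H) x))"
    if "N \<ge> 1" "k \<in> {..<N}" for N k
    using D[of "grid T N k" "grid T N (Suc k)"] that T grid_Suc[of T N k]
      grid_nonneg[OF T, of N k] grid_le[OF T, of "Suc k" N] by simp
  have pos: "(T / real N) powr x > 0" if "N \<ge> 1" for N x using that T by simp
  have mgf: "(\<integral>\<^sup>+\<omega>. ennreal (exp (c * (?Z N k \<omega> / (T / real N) powr H))) \<partial>M) = ennreal (exp (1/2))"
    if "N \<ge> 1" "k \<in> {..<N}" "c\<^sup>2 = 1" for N k c
    using exp_moment_normal[OF D'[OF that(1,2)] pos[OF that(1)], of "c / (T / real N) powr H"] pos[OF that(1), of H] that(3)
    by (simp add: power_divide)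
  have "AE \<omega> in M. \<exists>K\<ge>0. \<forall>N\<ge>1. \<forall>k\<in>{..<N}. \<bar>?Z N k \<omega>\<bar> \<le> K * (T / real N) powr a"
  proof (rule AE_bound_from_exponential_moments[where \<sigma> = "\<lambda>N k. (T / real N) powr H" and C = "exp (1/2)"
        and c = "T powr (a - H)" and \<gamma> = "H - a"])
    show "random_variable borel (?Z N k)" if "N \<ge> 1" "k \<in> {..<N}" for N k
      using distributed_measurable[OF D'[OF that]] by simp
    show "(\<integral>\<^sup>+\<omega>. ennreal (exp (?Z N k \<omega> / (T / real N) powr H)) \<partial>M) \<le> ennreal (exp (1/2))"
      "(\<integral>\<^sup>+\<omega>. ennreal (exp (- ?Z N k \<omega> / (T / real N) powr H)) \<partial>M) \<le> ennreal (exp (1/2))"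
      if "N \<ge> 1" "k \<in> {..<N}" for N k
      using mgf[OF that, of 1] mgf[OF that, of "-1"] by simp_all
    show "T powr (a - H) * real N powr (H - a) \<le> (T / real N) powr a / (T / real N) powr H"
      if "N \<ge> 1" for N
      using T that by (simp add: powr_diff powr_divide field_simps)
  qed (use T a pos in \<open>auto simp: power2_eq_square\<close>)
  with cont show ?thesis
  proof eventually_elim
    case (elim \<omega>)
    then obtain K where "K \<ge> 0" "\<forall>N\<ge>1. \<forall>k\<in>{..<N}. \<bar>?Z N k \<omega>\<bar> \<le> K * (T / real N) powr a" by blast
    then show ?case using elim by (intro holder_from_grid_increments T a) auto
  qed
qed

end

section \<open>Brownian motion\<close>

lemma borel_measurable_vec_component [measurable (raw)]:
  fixes f :: "'b \<Rightarrow> real ^ 'd"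
  assumes "f \<in> borel_measurable M"
  shows "(\<lambda>x. f x $ i) \<in> borel_measurable M"
  by (rule measurable_compose[OF assms]) (intro borel_measurable_continuous_onI continuous_intros)

context prob_space
begin

lemma brownian_motion_measurable:
  assumes "brownian_motion T W" "0 \<le> t" "t \<le> T"
  shows "random_variable borel (W t)"
  using assms by (auto simp: brownian_motion_def)

text \<open>The coordinate \<open>i\<close> is a marginal of the product density: the integrals over all other coordinates
  are 1.\<close>

lemma brownian_increment_component:
  fixes W :: "real \<Rightarrow> 'a \<Rightarrow> real ^ 'd"
  assumes W: "brownian_motion T W" and st: "0 \<le> s" "s < t" "t \<le> T"
  shows "distributed M lborel (\<lambda>\<omega>. W t \<omega> $ i - W s \<omega> $ i) (\<lambda>x. ennreal (normal_density 0 (sqrt (t - s)) x))"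
proof -
  let ?\<sigma> = "sqrt (t - s)"
  have \<sigma>: "?\<sigma> > 0" using st by simp
  have D: "distributed M lborel (\<lambda>\<omega>. W t \<omega> - W s \<omega>)
      (\<lambda>x. ennreal (\<Prod>i\<in>UNIV. normal_density 0 ?\<sigma> (x $ i)))"
    using W st unfolding brownian_motion_def by blast
  have [measurable]: "W t \<in> borel_measurable M" "W s \<in> borel_measurable M"
    using W st by (auto intro: brownian_motion_measurable)
  have rv [measurable]: "(\<lambda>\<omega>. W t \<omega> $ i - W s \<omega> $ i) \<in> borel_measurable M" by measurable
  have "distr M lborel (\<lambda>\<omega>. W t \<omega> $ i - W s \<omega> $ i) = density lborel (\<lambda>x. ennreal (normal_density 0 ?\<sigma> x))"
  proof (rule measure_eqI)
    fix A assume "A \<in> sets (distr M lborel (\<lambda>\<omega>. W t \<omega> $ i - W s \<omega> $ i))"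
    then have A [measurable]: "A \<in> sets borel" by simp
    let ?G = "\<lambda>j x. ennreal (normal_density 0 ?\<sigma> x) * (if j = i then indicator A x else 1)"
    let ?F = "\<lambda>b x. \<Prod>j | (axis j 1 :: real ^ 'd) = b. ?G j x"
    have ax: "{j. axis j 1 = (axis k 1 :: real ^ 'd)} = {k}" for k
      by (auto simp: axis_eq_axis)
    have "emeasure (distr M lborel (\<lambda>\<omega>. W t \<omega> $ i - W s \<omega> $ i)) A =
      (\<integral>\<^sup>+x. indicator A x \<partial>distr M lborel (\<lambda>\<omega>. W t \<omega> $ i - W s \<omega> $ i))"
      by simp
    also have "\<dots> = (\<integral>\<^sup>+\<omega>. indicator A ((W t \<omega> - W s \<omega>) $ i) \<partial>M)"
      by (subst nn_integral_distr) auto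
    also have "\<dots> = (\<integral>\<^sup>+x. ennreal (\<Prod>j\<in>UNIV. normal_density 0 ?\<sigma> (x $ j)) * indicator A (x $ i) \<partial>lborel)"
      by (rule distributed_nn_integral[OF D, symmetric]) measurable
    also have "\<dots> = (\<integral>\<^sup>+x. (\<Prod>b\<in>Basis. ?F b (x \<bullet> b)) \<partial>lborel)"
    proof (rule nn_integral_cong)
      fix x :: "real ^ 'd"
      have "(\<Prod>b\<in>Basis. ?F b (x \<bullet> b)) = (\<Prod>k\<in>UNIV. ?F (axis k 1) (x \<bullet> axis k 1))"
        by (intro prod.reindex_bij_betw[symmetric]) (auto simp: bij_betw_def inj_on_def axis_eq_axis Basis_vec_def)
      also have "\<dots> = (\<Prod>k\<in>UNIV. ?G k (x $ k))"
        by (simp add: ax inner_axis cong: if_cong)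
      also have "\<dots> = (\<Prod>k\<in>UNIV. ennreal (normal_density 0 ?\<sigma> (x $ k))) * (\<Prod>k\<in>UNIV. if k = i then indicator A (x $ k) else 1)"
        by (rule prod.distrib)
      also have "\<dots> = ennreal (\<Prod>j\<in>UNIV. normal_density 0 ?\<sigma> (x $ j)) * indicator A (x $ i)"
        by (simp add: prod_ennreal)
      finally show "ennreal (\<Prod>j\<in>UNIV. normal_density 0 ?\<sigma> (x $ j)) * indicator A (x $ i) =
          (\<Prod>b\<in>Basis. ?F b (x \<bullet> b))" by simp
    qed
    also have "\<dots> = (\<Prod>b\<in>Basis. \<integral>\<^sup>+x. ?F b x \<partial>lborel)"
      by (rule nn_integral_lborel_prod) auto
    also have "\<dots> = (\<Prod>k\<in>UNIV. \<integral>\<^sup>+x. ?F (axis k 1 :: real ^ 'd) x \<partial>lborel)"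
      by (intro prod.reindex_bij_betw[symmetric]) (auto simp: bij_betw_def inj_on_def axis_eq_axis Basis_vec_def)
    also have "\<dots> = (\<Prod>k\<in>UNIV. if k = i then \<integral>\<^sup>+x. ennreal (normal_density 0 ?\<sigma> x) * indicator A x \<partial>lborel else 1)"
      using \<sigma> by (intro prod.cong refl) (simp add: ax nn_integral_eq_integral)
    also have "\<dots> = emeasure (density lborel (\<lambda>x. ennreal (normal_density 0 ?\<sigma> x))) A"
      by (simp add: emeasure_density)
    finally show "emeasure (distr M lborel (\<lambda>\<omega>. W t \<omega> $ i - W s \<omega> $ i)) A =
      emeasure (density lborel (\<lambda>x. ennreal (normal_density 0 ?\<sigma> x))) A" .
  qed simp
  then show ?thesis by (simp add: distributed_def)
qed

lemma brownian_motion_holder: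
  fixes W :: "real \<Rightarrow> 'a \<Rightarrow> real ^ 'd"
  assumes W: "brownian_motion T W" and T: "T > 0" and a: "0 < a" "a < 1/2"
  shows "AE \<omega> in M. holder_on T a (\<lambda>t. W t \<omega> $ i)"
proof (rule holder_of_gaussian_increments[OF T a])
  show "distributed M lborel (\<lambda>\<omega>. W t \<omega> $ i - W s \<omega> $ i) (\<lambda>x. ennreal (normal_density 0 ((t - s) powr (1/2)) x))"
    if "0 \<le> s" "s < t" "t \<le> T" for s t
    using brownian_increment_component[OF W that, of i] that by (simp add: powr_half_sqrt)
  have "AE \<omega> in M. continuous_on {0..T} (\<lambda>t. W t \<omega>)"
    using W by (simp add: brownian_motion_def)
  then show "AE \<omega> in M. continuous_on {0..T} (\<lambda>t. W t \<omega> $ i)"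
    by eventually_elim (auto intro: continuous_intros)
qed

text \<open>For a fixed offset \<open>c\<close>, one summand per cell remains.  It depends only on the increments inside its
  cell, so the summands are independent; its two factors are built from disjoint sets of increments,
  so they are independent as well.\<close>

lemma brownian_area_exp_moment:
  fixes W :: "real \<Rightarrow> 'a \<Rightarrow> real ^ 'd"
  assumes W: "brownian_motion T W" and T: "T > 0" and N: "N \<ge> 1" and c: "1 \<le> c" "c < q"
    and kl: "l \<le> N" and small: "(\<theta> * (T / real N))\<^sup>2 \<le> 1/2"
  shows "(\<integral>\<^sup>+\<omega>. ennreal (exp (\<theta> * (\<Sum>j=k..<l.
      (W (grid T (N * q) (j * q + c)) \<omega> $ i - W (grid T N j) \<omega> $ i) *
      (W (grid T (N * q) (Suc (j * q + c))) \<omega> $ i' - W (grid T (N * q) (j * q + c)) \<omega> $ i')))) \<partial>M)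
     \<le> ennreal (exp (real (l - k) * (\<theta> * (T / real N))\<^sup>2))"
proof -
  define g where "g = grid T (N * q)"
  have q: "q \<ge> 1" using c by simp
  have gT: "0 \<le> g r" "r \<le> N * q \<Longrightarrow> g r \<le> T" for r
    using T by (auto simp: g_def intro: grid_nonneg grid_le)
  have gmono: "r \<le> r' \<Longrightarrow> g r \<le> g r'" for r r' using T by (auto simp: g_def intro: grid_mono)
  define D where "D = (\<lambda>r \<omega>. W (g (Suc r)) \<omega> - W (g r) \<omega>)"
  have indD: "indep_vars (\<lambda>_. borel) D {..<N * q}"
    using W gT gmono unfolding brownian_motion_def D_def by auto
  define \<xi> where "\<xi> = (\<lambda>j \<omega>. W (g (j * q + c)) \<omega> $ i - W (g (j * q)) \<omega> $ i)"
  define \<zeta> where "\<zeta> = (\<lambda>j \<omega>. W (g (Suc (j * q + c))) \<omega> $ i' - W (g (j * q + c)) \<omega> $ i')"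
  have \<xi>D: "\<xi> j \<omega> = (\<Sum>r\<in>{j*q..<j*q+c}. D r \<omega> $ i)" for j \<omega>
    using sum_Suc_diff'[of "j*q" "j*q+c" "\<lambda>r. W (g r) \<omega> $ i"] by (simp add: \<xi>_def D_def)
  have \<zeta>D: "\<zeta> j \<omega> = D (j*q+c) \<omega> $ i'" for j \<omega> by (simp add: \<zeta>_def D_def)
  have blk: "j * q + r < N * q" if "j < N" "r < q" for j r
  proof -
    have "j * q + r < Suc j * q" using that by simp
    also have "\<dots> \<le> N * q" using that by (intro mult_le_mono1) simp
    finally show ?thesis .
  qed
  have step: "g (j * q + r) - g (j * q) = real r * (T / real (N * q))" for j r
    by (simp add: g_def grid_def add_divide_distrib algebra_simps)
  let ?h = "T / real N"
  have h: "?h > 0" using T N by simp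
  have hq: "real r * (T / real (N * q)) \<le> ?h" if "r \<le> q" for r
  proof -
    have "real r * (T / real (N * q)) = (real r / real q) * ?h" by simp
    also have "\<dots> \<le> 1 * ?h" using that q h by (intro mult_right_mono) auto
    finally show ?thesis by simp
  qed
  have one: "(\<integral>\<^sup>+\<omega>. ennreal (exp (\<theta> * (\<xi> j \<omega> * \<zeta> j \<omega>))) \<partial>M) \<le> ennreal (exp ((\<theta> * ?h)\<^sup>2))" if j: "j < N" for j
  proof -
    let ?A = "{j*q..<j*q+c}" and ?B = "{j*q+c}"
    have AB: "?A \<inter> ?B = {}" "?A \<subseteq> {..<N*q}" "?B \<subseteq> {..<N*q}"
      using blk[OF j, of c] c by auto
    have "indep_var borel ((\<lambda>x. \<Sum>r\<in>?A. x r $ i) \<circ> (\<lambda>\<omega>. restrict (\<lambda>r. D r \<omega>) ?A))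
       borel ((\<lambda>x. x (j*q+c) $ i') \<circ> (\<lambda>\<omega>. restrict (\<lambda>r. D r \<omega>) ?B))"
      by (rule indep_var_compose[OF indep_var_restrict[OF indD AB]]) measurable
    moreover have "(\<lambda>x. \<Sum>r\<in>?A. x r $ i) \<circ> (\<lambda>\<omega>. restrict (\<lambda>r. D r \<omega>) ?A) = \<xi> j"
      "(\<lambda>x. x (j*q+c) $ i') \<circ> (\<lambda>\<omega>. restrict (\<lambda>r. D r \<omega>) ?B) = \<zeta> j"
      by (auto simp: \<xi>D \<zeta>D fun_eq_iff)
    ultimately have ind: "indep_var borel (\<xi> j) borel (\<zeta> j)" by simp
    let ?s = "g (j * q + c) - g (j * q)" and ?r = "g (Suc (j * q + c)) - g (j * q + c)"
    have sr: "0 < ?s" "?s \<le> ?h" "0 < ?r" "?r \<le> ?h"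
    proof -
      have d: "0 < T / real (N * q)" using T N q by simp
      have "?s = real c * (T / real (N * q))" by (rule step)
      then show "0 < ?s" "?s \<le> ?h" using mult_pos_pos[OF _ d, of "real c"] hq[of c] c by auto
      have "?r = T / real (N * q)" by (simp add: g_def grid_Suc)
      then show "0 < ?r" "?r \<le> ?h" using d hq[of 1] q by auto
    qed
    have "distributed M lborel (\<xi> j) (\<lambda>x. ennreal (normal_density 0 (sqrt ?s) x))"
      unfolding \<xi>_def using sr blk[OF j, of c] c gT by (intro brownian_increment_component[OF W]) auto
    moreover have "distributed M lborel (\<zeta> j) (\<lambda>x. ennreal (normal_density 0 (sqrt ?r) x))"
      unfolding \<zeta>_def using sr blk[OF j, of c] c gT by (intro brownian_increment_component[OF W]) auto
    moreover have sq: "(\<theta> * sqrt ?s * sqrt ?r)\<^sup>2 \<le> (\<theta> * ?h)\<^sup>2"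
    proof -
      have "(\<theta> * sqrt ?s * sqrt ?r)\<^sup>2 = \<theta>\<^sup>2 * (?s * ?r)" using sr by (simp add: power_mult_distrib)
      also have "\<dots> \<le> \<theta>\<^sup>2 * (?h * ?h)" using sr h by (intro mult_left_mono mult_mono) auto
      finally show ?thesis by (simp add: power2_eq_square ac_simps)
    qed
    ultimately have "(\<integral>\<^sup>+\<omega>. ennreal (exp (\<theta> * (\<xi> j \<omega> * \<zeta> j \<omega>))) \<partial>M) \<le> ennreal (exp ((\<theta> * sqrt ?s * sqrt ?r)\<^sup>2))"
      using sr small by (intro exp_moment_indep_normal_product[OF ind]) auto
    also have "\<dots> \<le> ennreal (exp ((\<theta> * ?h)\<^sup>2))" using sq by (simp add: ennreal_leI)
    finally show ?thesis .
  qed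
  have indY: "indep_vars (\<lambda>_. borel) (\<lambda>j \<omega>. ennreal (exp (\<theta> * (\<xi> j \<omega> * \<zeta> j \<omega>)))) {k..<l}"
  proof -
    let ?K = "\<lambda>j. {j*q..<j*q+q}"
    have K: "?K j \<subseteq> {..<N*q}" if "j \<in> {k..<l}" for j
      using blk[of j "q - 1"] that kl q by auto
    have disj: "disjoint_family_on ?K {k..<l}"
    proof (unfold disjoint_family_on_def, safe)
      fix j j' x assume "j \<noteq> j'" and x: "x \<in> ?K j" "x \<in> ?K j'"
      have "x div q = j" "x div q = j'"
        using x q by (auto intro!: div_nat_eqI simp: mult.commute)
      then show "x \<in> {}" using \<open>j \<noteq> j'\<close> by simp
    qed
    have "indep_vars (\<lambda>_. borel)
      (\<lambda>j \<omega>. (\<lambda>x. ennreal (exp (\<theta> * ((\<Sum>r\<in>{j*q..<j*q+c}. x r $ i) * (x (j*q+c) $ i'))))) (restrict (\<lambda>r. D r \<omega>) (?K j))) {k..<l}"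
    proof (rule indep_vars_compose2[OF indep_vars_restrict[OF indD K disj]])
      fix j assume "j \<in> {k..<l}"
      have [measurable]: "(\<lambda>x. x r) \<in> measurable (PiM (?K j) (\<lambda>_. borel :: (real ^ 'd) measure)) borel"
        if "r \<in> ?K j" for r using that by (rule measurable_component_singleton)
      have [measurable]: "(\<lambda>x. x (j*q+c)) \<in> measurable (PiM (?K j) (\<lambda>_. borel :: (real ^ 'd) measure)) borel"
        using c by (intro measurable_component_singleton) auto
      have "(\<lambda>x. \<Sum>r\<in>{j*q..<j*q+c}. x r $ i) \<in> borel_measurable (PiM (?K j) (\<lambda>_. borel :: (real ^ 'd) measure))"
        using c by (intro borel_measurable_sum) auto
      moreover have "(\<lambda>x. x (j*q+c) $ i') \<in> borel_measurable (PiM (?K j) (\<lambda>_. borel :: (real ^ 'd) measure))"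
        by measurable
      ultimately show "(\<lambda>x. ennreal (exp (\<theta> * ((\<Sum>r\<in>{j*q..<j*q+c}. x r $ i) * (x (j*q+c) $ i')))))
          \<in> borel_measurable (PiM (?K j) (\<lambda>_. borel))" by measurable
    qed
    also have "(\<lambda>j \<omega>. (\<lambda>x. ennreal (exp (\<theta> * ((\<Sum>r\<in>{j*q..<j*q+c}. x r $ i) * (x (j*q+c) $ i'))))) (restrict (\<lambda>r. D r \<omega>) (?K j)))
      = (\<lambda>j \<omega>. ennreal (exp (\<theta> * (\<xi> j \<omega> * \<zeta> j \<omega>))))"
      using c by (simp add: \<xi>D \<zeta>D)
    finally show ?thesis .
  qed
  have "(\<integral>\<^sup>+\<omega>. ennreal (exp (\<theta> * (\<Sum>j=k..<l. \<xi> j \<omega> * \<zeta> j \<omega>))) \<partial>M) =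
     (\<integral>\<^sup>+\<omega>. (\<Prod>j=k..<l. ennreal (exp (\<theta> * (\<xi> j \<omega> * \<zeta> j \<omega>)))) \<partial>M)"
    by (simp add: sum_distrib_left exp_sum prod_ennreal)
  also have "\<dots> = (\<Prod>j=k..<l. \<integral>\<^sup>+\<omega>. ennreal (exp (\<theta> * (\<xi> j \<omega> * \<zeta> j \<omega>))) \<partial>M)"
    by (rule indep_vars_nn_integral[OF _ indY]) auto
  also have "\<dots> \<le> (\<Prod>j=k..<l. ennreal (exp ((\<theta> * ?h)\<^sup>2)))"
    using kl by (intro prod_mono_ennreal one) auto
  also have "\<dots> = ennreal (exp (real (l - k) * (\<theta> * ?h)\<^sup>2))"
    by (simp add: ennreal_power exp_of_nat_mult)
  finally show ?thesis
    by (simp add: \<xi>_def \<zeta>_def g_def grid_refine[OF q])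
qed

text \<open>For each offset \<open>c\<close> the area of the strip over cells \<open>k, ..., l - 1\<close> is compared with its scale
  \<open>sqrt (l - k) * h\<close>; the sum over the \<open>q\<close> offsets only changes the constant.\<close>

lemma brownian_refinement_bound:
  fixes W :: "real \<Rightarrow> 'a \<Rightarrow> real ^ 'd"
  assumes W: "brownian_motion T W" and T: "T > 0"
    and ex: "\<beta> \<ge> 1/2" "\<eta> + \<beta> < 1"
  shows "AE \<omega> in M. refinement_bound T \<eta> \<beta> (\<lambda>t. W t \<omega> $ i) (\<lambda>t. W t \<omega> $ i')"
proof -
  let ?\<xi> = "\<lambda>q c N j \<omega>. W (grid T (N * q) (j * q + c)) \<omega> $ i - W (grid T N j) \<omega> $ i"
  let ?\<zeta> = "\<lambda>q c N j \<omega>. W (grid T (N * q) (Suc (j * q + c))) \<omega> $ i' - W (grid T (N * q) (j * q + c)) \<omega> $ i'"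
  define Z where "Z = (\<lambda>q c N (k, l) \<omega>. \<Sum>j=k..<l. ?\<xi> q c N j \<omega> * ?\<zeta> q c N j \<omega>)"
  define I where "I = (\<lambda>N::nat. {(k, l). k < l \<and> l \<le> N})"
  define b where "b = (\<lambda>N (k, l). (T / real N) powr \<eta> * (grid T N l - grid T N k) powr \<beta>)"
  define \<sigma> where "\<sigma> = (\<lambda>N (k, l). 2 * sqrt (real (l - k)) * (T / real N))"
  have strip: "AE \<omega> in M. \<exists>K\<ge>0. \<forall>N\<ge>1. \<forall>kl\<in>I N. \<bar>Z q c N kl \<omega>\<bar> \<le> K * b N kl"
    if c: "1 \<le> c" "c < q" for q c
  proof (rule AE_bound_from_exponential_moments[where \<sigma> = \<sigma> and C = "exp (1/4)"
        and c = "T powr (\<eta> + \<beta> - 1) / 2" and \<gamma> = "1 - \<eta> - \<beta>"])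
    have sub: "I N \<subseteq> {..<N} \<times> {1..N}" for N by (auto simp: I_def)
    then show "finite (I N)" for N by (rule finite_subset) simp
    have "card (I N) \<le> card ({..<N} \<times> {1..N})" for N by (rule card_mono[OF _ sub]) simp
    then show "card (I N) \<le> N ^ 2" for N by (simp add: power2_eq_square)
    fix N kl assume N: "N \<ge> (1::nat)" and "kl \<in> I N"
    then obtain k l where kl: "kl = (k, l)" "k < l" "l \<le> N" by (auto simp: I_def)
    let ?h = "T / real N" and ?m = "real (l - k)"
    have h: "?h > 0" using T N by simp
    have m: "?m \<ge> 1" using kl by simp
    have fineT: "grid T (N * q) (j * q + r) \<le> T" if "j < N" "r \<le> q" for j r
      using fine_grid_in_cell(2)[OF T that(2), of N j] grid_le[OF T, of "Suc j" N] that c by auto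
    show "random_variable borel (Z q c N kl)"
      unfolding Z_def kl prod.case
    proof (intro borel_measurable_sum borel_measurable_times borel_measurable_diff)
      fix j assume "j \<in> {k..<l}"
      then have j: "j < N" using kl by simp
      have m: "W (grid T (N * q) (j * q + r)) \<in> borel_measurable M" if "r \<le> q" for r
        using fineT[OF j that] T by (intro brownian_motion_measurable[OF W] grid_nonneg)
      have [measurable]: "W (grid T (N * q) (j * q + c)) \<in> borel_measurable M"
        "W (grid T (N * q) (Suc (j * q + c))) \<in> borel_measurable M"
        using m[of c] m[of "Suc c"] c by simp_all
      have [measurable]: "W (grid T N j) \<in> borel_measurable M"
        using j T by (intro brownian_motion_measurable[OF W] grid_nonneg grid_le) auto
      show "(\<lambda>\<omega>. W (grid T (N * q) (j * q + c)) \<omega> $ i) \<in> borel_measurable M"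
        "(\<lambda>\<omega>. W (grid T (N * q) (j * q + c)) \<omega> $ i') \<in> borel_measurable M"
        "(\<lambda>\<omega>. W (grid T N j) \<omega> $ i) \<in> borel_measurable M"
        "(\<lambda>\<omega>. W (grid T (N * q) (Suc (j * q + c))) \<omega> $ i') \<in> borel_measurable M"
        by measurable
    qed
    show "\<sigma> N kl > 0" unfolding \<sigma>_def kl prod.case using h m by (intro mult_pos_pos) auto
    have L: "grid T N l - grid T N k = ?m * ?h" using kl by (intro grid_diff) auto
    show "b N kl > 0"
      unfolding b_def kl prod.case L using T N h m mult_pos_pos[of ?m ?h] by (intro mult_pos_pos) auto
    have mgf: "(\<integral>\<^sup>+\<omega>. ennreal (exp ((x / \<sigma> N kl) * Z q c N kl \<omega>)) \<partial>M) \<le> ennreal (exp (1/4))" if x: "x\<^sup>2 = 1" for x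
    proof -
      \<comment> \<open>the factor 2 in \<open>\<sigma>\<close> keeps this below \<open>1 / 2\<close> even for a single cell\<close>
      have e: "(x / \<sigma> N kl * ?h)\<^sup>2 = 1 / (4 * ?m)"
      proof -
        have "(x / (2 * sqrt m' * h') * h')\<^sup>2 = 1 / (4 * m')" if "h' > 0" "m' \<ge> 1" for h' m' :: real
          using x that by (simp add: power_mult_distrib power_divide)
        from this[OF h m] show ?thesis by (simp add: \<sigma>_def kl)
      qed
      have "(\<integral>\<^sup>+\<omega>. ennreal (exp ((x / \<sigma> N kl) * Z q c N kl \<omega>)) \<partial>M) \<le> ennreal (exp (?m * (x / \<sigma> N kl * ?h)\<^sup>2))"
        unfolding Z_def kl(1) prod.case
        using m by (intro brownian_area_exp_moment[OF W T N c kl(3)] ; (subst e[unfolded kl(1)])?) (auto simp: field_simps)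
      also have "?m * (x / \<sigma> N kl * ?h)\<^sup>2 = 1/4" unfolding e using m by simp
      finally show ?thesis .
    qed
    show "(\<integral>\<^sup>+\<omega>. ennreal (exp (Z q c N kl \<omega> / \<sigma> N kl)) \<partial>M) \<le> ennreal (exp (1/4))"
      "(\<integral>\<^sup>+\<omega>. ennreal (exp (- Z q c N kl \<omega> / \<sigma> N kl)) \<partial>M) \<le> ennreal (exp (1/4))"
      using mgf[of 1] mgf[of "-1"] by simp_all
    have "T powr (\<eta> + \<beta> - 1) / 2 * real N powr (1 - \<eta> - \<beta>) = ?h powr (\<eta> + \<beta> - 1) / 2"
      using T N by (simp add: powr_divide powr_minus_divide[symmetric] powr_diff powr_add field_simps)
    also have "\<dots> \<le> ?m powr (\<beta> - 1/2) * ?h powr (\<eta> + \<beta> - 1) / 2"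
      using m ex ge_one_powr_ge_zero[of ?m "\<beta> - 1/2"] mult_right_mono[of 1 "?m powr (\<beta> - 1/2)" "?h powr (\<eta> + \<beta> - 1)"] by simp
    also have "\<dots> = b N kl / \<sigma> N kl"
    proof -
      have "?m powr (\<beta> - 1/2) = ?m powr \<beta> / sqrt ?m" using m by (simp add: powr_diff powr_half_sqrt)
      moreover have "?h powr (\<eta> + \<beta> - 1) = ?h powr \<eta> * ?h powr \<beta> / ?h"
        using h by (simp only: powr_diff powr_add powr_one)
      moreover have "(?m * ?h) powr \<beta> = ?m powr \<beta> * ?h powr \<beta>" by (rule powr_mult)
      ultimately show ?thesis by (simp only: b_def \<sigma>_def kl prod.case L) (simp add: ac_simps)
    qed
    finally show "T powr (\<eta> + \<beta> - 1) / 2 * real N powr (1 - \<eta> - \<beta>) \<le> b N kl / \<sigma> N kl" .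
  qed (use T ex in auto)
  have "AE \<omega> in M. \<forall>q c. 1 \<le> c \<longrightarrow> c < q \<longrightarrow> (\<exists>K\<ge>0. \<forall>N\<ge>1. \<forall>kl\<in>I N. \<bar>Z q c N kl \<omega>\<bar> \<le> K * b N kl)"
    using strip by (auto simp: AE_all_countable)
  then show ?thesis
  proof eventually_elim
    case (elim \<omega>)
    show ?case unfolding refinement_bound_def
    proof (intro allI impI)
      fix q :: nat assume q: "q \<ge> 1"
      have "\<forall>c. \<exists>K\<ge>0. 1 \<le> c \<longrightarrow> c < q \<longrightarrow> (\<forall>N\<ge>1. \<forall>kl\<in>I N. \<bar>Z q c N kl \<omega>\<bar> \<le> K * b N kl)"
        using elim by (metis order.refl)
      then obtain K where K: "\<And>c. K c \<ge> 0"
        "\<And>c N kl. 1 \<le> c \<Longrightarrow> c < q \<Longrightarrow> N \<ge> 1 \<Longrightarrow> kl \<in> I N \<Longrightarrow> \<bar>Z q c N kl \<omega>\<bar> \<le> K c * b N kl"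
        by metis
      have "\<bar>\<Sum>j=k..<l. cell_area T N q (\<lambda>t. W t \<omega> $ i) (\<lambda>t. W t \<omega> $ i') j\<bar>
          \<le> (\<Sum>c<q. K c) * (T / real N) powr \<eta> * (grid T N l - grid T N k) powr \<beta>"
        if N: "N \<ge> 1" and kl: "k < l" "l \<le> N" for N k l
      proof -
        have b0: "b N (k, l) \<ge> 0" by (simp add: b_def)
        have "(\<Sum>j=k..<l. cell_area T N q (\<lambda>t. W t \<omega> $ i) (\<lambda>t. W t \<omega> $ i') j) =
           (\<Sum>c<q. Z q c N (k, l) \<omega>)"
          unfolding cell_area_def Z_def prod.case by (rule sum.swap)
        also have "\<bar>\<dots>\<bar> \<le> (\<Sum>c<q. K c * b N (k, l))"
        proof (intro order.trans[OF sum_abs] sum_mono)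
          fix c assume c: "c \<in> {..<q}"
          show "\<bar>Z q c N (k, l) \<omega>\<bar> \<le> K c * b N (k, l)"
          proof (cases "c = 0")
            case True
            then have "Z q c N (k, l) \<omega> = 0" by (simp add: Z_def grid_refine[OF q])
            then show ?thesis using K(1)[of c] b0 by simp
          next
            case False
            then show ?thesis using c N kl by (intro K(2)) (auto simp: I_def)
          qed
        qed
        also have "\<dots> = (\<Sum>c<q. K c) * (T / real N) powr \<eta> * (grid T N l - grid T N k) powr \<beta>"
          by (simp add: b_def sum_distrib_right[symmetric])
        finally show ?thesis .
      qed
      moreover have "(\<Sum>c<q. K c) \<ge> 0" using K by (intro sum_nonneg) auto
      ultimately show "\<exists>K\<ge>0. \<forall>N\<ge>1. \<forall>k l. k < l \<longrightarrow> l \<le> N \<longrightarrow>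
        \<bar>\<Sum>j=k..<l. cell_area T N q (\<lambda>t. W t \<omega> $ i) (\<lambda>t. W t \<omega> $ i') j\<bar> \<le>
          K * (T / real N) powr \<eta> * (grid T N l - grid T N k) powr \<beta>" by blast
    qed
  qed
qed

end

section \<open>Fractional Brownian motion\<close>

context prob_space
begin

lemma gaussian_rv_square_integrable:
  assumes "gaussian_rv Z"
  shows "integrable M (\<lambda>\<omega>. (Z \<omega>)\<^sup>2)"
proof -
  have [measurable]: "random_variable borel Z" using assms by (simp add: gaussian_rv_def)
  from assms obtain \<mu> where "(AE \<omega> in M. Z \<omega> = \<mu>) \<or>
          (\<exists>\<sigma>>0. distributed M lborel Z (\<lambda>x. ennreal (normal_density \<mu> \<sigma> x)))"
    by (auto simp: gaussian_rv_def)
  then show ?thesis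
  proof (elim disjE exE conjE)
    assume "AE \<omega> in M. Z \<omega> = \<mu>"
    then have "AE \<omega> in M. \<mu>\<^sup>2 = (Z \<omega>)\<^sup>2" by eventually_elim simp
    then show ?thesis by (rule integrable_cong_AE_imp[rotated 2]) auto
  next
    fix \<sigma> :: real assume \<sigma>: "\<sigma> > 0" and D: "distributed M lborel Z (\<lambda>x. ennreal (normal_density \<mu> \<sigma> x))"
    have "integrable lborel (\<lambda>x. normal_density \<mu> \<sigma> x * (x - \<mu>)^2 + 2 * \<mu> * (normal_density \<mu> \<sigma> x * x) - \<mu>\<^sup>2 * normal_density \<mu> \<sigma> x)"
      using \<sigma> by (intro Bochner_Integration.integrable_add Bochner_Integration.integrable_diff
          integrable_mult_right integrable_normal_moment integrable_normal_moment_nz_1 integrable_normal_density)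
    also have "(\<lambda>x. normal_density \<mu> \<sigma> x * (x - \<mu>)^2 + 2 * \<mu> * (normal_density \<mu> \<sigma> x * x) - \<mu>\<^sup>2 * normal_density \<mu> \<sigma> x)
       = (\<lambda>x. normal_density \<mu> \<sigma> x * x\<^sup>2)"
      by (simp add: fun_eq_iff power2_eq_square algebra_simps)
    finally show ?thesis
      by (subst (asm) distributed_integrable[OF D]) auto
  qed
qed

text \<open>The increment is Gaussian with mean 0, and the covariance function gives its variance
  \<open>(t - s)\<^sup>2\<^sup>H\<close>; as this is positive, the increment is not a point mass.\<close>

lemma fractional_brownian_increment:
  assumes B: "fractional_brownian_motion_1 T H B" and st: "0 \<le> s" "s < t" "t \<le> T"
  shows "distributed M lborel (\<lambda>\<omega>. B t \<omega> - B s \<omega>) (\<lambda>x. ennreal (normal_density 0 ((t - s) powr H) x))"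
proof -
  have lin: "gaussian_rv (\<lambda>\<omega>. \<Sum>r\<in>J. c r * B r \<omega>)" if "finite J" "J \<subseteq> {0..T}" for J c
    using B that by (auto simp: fractional_brownian_motion_1_def gaussian_process_def)
  have single: "gaussian_rv (B r)" if "r \<in> {0..T}" for r
    using lin[of "{r}" "\<lambda>_. 1"] that by simp
  define Z where "Z = (\<lambda>\<omega>. B t \<omega> - B s \<omega>)"
  have "gaussian_rv (\<lambda>\<omega>. \<Sum>r\<in>{s, t}. (if r = t then 1 else -1) * B r \<omega>)"
    using st by (intro lin) auto
  then have Z: "gaussian_rv Z" using st by (simp add: Z_def)
  have rv [measurable]: "random_variable borel (B r)" if "r \<in> {0..T}" for r
    using single[OF that] by (simp add: gaussian_rv_def)
  have mem: "s \<in> {0..T}" "t \<in> {0..T}" using st by auto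
  note [measurable] = rv[OF mem(1)] rv[OF mem(2)]
  have sq: "integrable M (\<lambda>\<omega>. (B r \<omega>)\<^sup>2)" if "r \<in> {0..T}" for r
    using gaussian_rv_square_integrable[OF single[OF that]] .
  have int: "integrable M (B r)" if "r \<in> {0..T}" for r
    using square_integrable_imp_integrable[OF rv[OF that] sq[OF that]] .
  have prod: "integrable M (\<lambda>\<omega>. B s \<omega> * B t \<omega>)"
  proof (rule Bochner_Integration.integrable_bound)
    show "integrable M (\<lambda>\<omega>. (B s \<omega>)\<^sup>2 + (B t \<omega>)\<^sup>2)" using sq mem by simp
    have "\<bar>x * y\<bar> \<le> x\<^sup>2 + y\<^sup>2" for x y :: real
    proof -
      have "2 * (\<bar>x\<bar> * \<bar>y\<bar>) \<le> x\<^sup>2 + y\<^sup>2"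
        using zero_le_power2[of "\<bar>x\<bar> - \<bar>y\<bar>"] by (simp add: power2_diff)
      moreover have "0 \<le> \<bar>x\<bar> * \<bar>y\<bar>" by simp
      ultimately show ?thesis unfolding abs_mult by linarith
    qed
    then show "AE \<omega> in M. norm (B s \<omega> * B t \<omega>) \<le> norm ((B s \<omega>)\<^sup>2 + (B t \<omega>)\<^sup>2)"
      by (intro always_eventually allI) (simp del: abs_mult)
  qed simp
  have cov: "expectation (\<lambda>\<omega>. B r \<omega> * B r' \<omega>) = (r powr (2 * H) + r' powr (2 * H) - \<bar>r' - r\<bar> powr (2 * H)) / 2"
    if "r \<in> {0..T}" "r' \<in> {0..T}" for r r'
    using B that by (auto simp: fractional_brownian_motion_1_def)
  have EZ: "expectation Z = 0"
    using B mem int by (simp add: Z_def fractional_brownian_motion_1_def)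
  have "expectation (\<lambda>\<omega>. (Z \<omega>)\<^sup>2) = expectation (\<lambda>\<omega>. (B t \<omega>)\<^sup>2 + (B s \<omega>)\<^sup>2 - 2 * (B s \<omega> * B t \<omega>))"
    by (simp add: Z_def power2_diff algebra_simps)
  also have "\<dots> = expectation (\<lambda>\<omega>. (B t \<omega>)\<^sup>2) + expectation (\<lambda>\<omega>. (B s \<omega>)\<^sup>2) - 2 * expectation (\<lambda>\<omega>. B s \<omega> * B t \<omega>)"
    using sq mem prod by simp
  also have "\<dots> = ((t - s) powr H)\<^sup>2"
  proof -
    have "((t - s) powr H)\<^sup>2 = (t - s) powr (2 * H)"
      using powr_add[of "t - s" H H] by (simp add: power2_eq_square)
    moreover have "expectation (\<lambda>\<omega>. (B r \<omega>)\<^sup>2) = r powr (2 * H)" if "r \<in> {0..T}" for r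
      using cov[OF that that] by (simp add: power2_eq_square)
    ultimately show ?thesis using cov[OF mem] mem st by (simp add: field_simps)
  qed
  finally have VZ: "expectation (\<lambda>\<omega>. (Z \<omega>)\<^sup>2) = ((t - s) powr H)\<^sup>2" .
  from Z obtain \<mu> where "(AE \<omega> in M. Z \<omega> = \<mu>) \<or>
          (\<exists>\<sigma>>0. distributed M lborel Z (\<lambda>x. ennreal (normal_density \<mu> \<sigma> x)))"
    by (auto simp: gaussian_rv_def)
  then show ?thesis
  proof (elim disjE exE conjE)
    assume const: "AE \<omega> in M. Z \<omega> = \<mu>"
    have [measurable]: "random_variable borel Z" unfolding Z_def by measurable
    have "expectation Z = expectation (\<lambda>_. \<mu>)" by (rule integral_cong_AE) (use const in auto)
    then have "\<mu> = 0" using EZ by (simp add: prob_space)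
    then have "expectation (\<lambda>\<omega>. (Z \<omega>)\<^sup>2) = expectation (\<lambda>_. 0)"
      using const by (intro integral_cong_AE) auto
    then show ?thesis using VZ st by simp
  next
    fix \<sigma> :: real assume \<sigma>: "\<sigma> > 0" and D: "distributed M lborel Z (\<lambda>x. ennreal (normal_density \<mu> \<sigma> x))"
    have \<mu>: "\<mu> = 0" using normal_distributed_expectation[OF \<sigma> D] EZ by simp
    have "\<sigma>\<^sup>2 = ((t - s) powr H)\<^sup>2"
      using normal_distributed_variance[OF \<sigma> D] EZ VZ by simp
    then have "\<sigma> = (t - s) powr H" by (rule power2_eq_imp_eq) (use \<sigma> in auto)
    then show ?thesis using D \<mu> by (simp add: Z_def)
  qed
qed

lemma fractional_brownian_motion_holder:
  fixes B :: "real \<Rightarrow> 'a \<Rightarrow> real ^ 'd"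
  assumes B: "fractional_brownian_motion T H B" and T: "T > 0" and a: "0 < a" "a < H"
  shows "AE \<omega> in M. holder_on T a (\<lambda>t. B t \<omega> $ i)"
proof (rule holder_of_gaussian_increments[OF T a])
  have 1: "fractional_brownian_motion_1 T H (\<lambda>t \<omega>. B t \<omega> $ i)"
    using B by (simp add: fractional_brownian_motion_def)
  show "distributed M lborel (\<lambda>\<omega>. B t \<omega> $ i - B s \<omega> $ i) (\<lambda>x. ennreal (normal_density 0 ((t - s) powr H) x))"
    if "0 \<le> s" "s < t" "t \<le> T" for s t
    by (rule fractional_brownian_increment[OF 1 that])
  show "AE \<omega> in M. continuous_on {0..T} (\<lambda>t. B t \<omega> $ i)"
    using 1 by (simp add: fractional_brownian_motion_1_def)
qed

end

section \<open>Property (RIE) from bounds on the coordinates\<close>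

lemma uniform_limit_of_bound:
  fixes F :: "nat \<Rightarrow> 'b \<Rightarrow> 'c::real_normed_vector"
  assumes "\<And>n x. x \<in> S \<Longrightarrow> norm (F n x - L x) \<le> e n" "e \<longlonglongrightarrow> 0"
  shows "uniform_limit S F L sequentially"
proof (rule uniform_limitI)
  fix \<epsilon> :: real assume "\<epsilon> > 0"
  with assms(2) have "\<forall>\<^sub>F n in sequentially. e n < \<epsilon>" by (rule order_tendstoD)
  then show "\<forall>\<^sub>F n in sequentially. \<forall>x\<in>S. dist (F n x) (L x) < \<epsilon>"
    by eventually_elim (auto simp: dist_norm intro: le_less_trans[OF assms(1)])
qed

lemma norm_vec_le_sum:
  fixes x :: "real ^ 'd"
  assumes "\<And>i. \<bar>x $ i\<bar> \<le> C i"
  shows "norm x \<le> sum C UNIV"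
  using norm_le_l1_cart[of x] sum_mono[of UNIV "\<lambda>i. \<bar>x $ i\<bar>" C] assms by (meson order_trans)

lemma norm_matrix_le_sum:
  fixes x :: "real ^ 'd ^ 'e"
  assumes "\<And>i j. \<bar>x $ i $ j\<bar> \<le> C i j"
  shows "norm x \<le> (\<Sum>i\<in>UNIV. \<Sum>j\<in>UNIV. C i j)"
proof -
  have "norm x \<le> (\<Sum>i\<in>UNIV. norm (x $ i))" by (simp add: norm_vec_def L2_set_le_sum)
  also have "\<dots> \<le> (\<Sum>i\<in>UNIV. \<Sum>j\<in>UNIV. C i j)"
    by (intro sum_mono norm_vec_le_sum assms)
  finally show ?thesis .
qed

lemma ennreal_quotient_le:
  assumes "0 \<le> a" "a \<le> c * w" "0 \<le> c" "0 \<le> w"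
  shows "ennreal a / ennreal w \<le> ennreal c"
proof (cases "w = 0")
  case False
  then show ?thesis using assms by (simp add: divide_ennreal ennreal_leI field_simps)
qed (use assms in simp)

lemma equidistant_partition_grid:
  assumes "is_partition T N u" "T > 0" "\<And>i. i < N \<Longrightarrow> u (Suc i) - u i = \<pi>"
  shows "N \<ge> 1" "\<pi> = T / real N" "k \<le> N \<Longrightarrow> u k = grid T N k"
proof -
  have lin: "u k = real k * \<pi>" if "k \<le> N" for k
    using that assms by (induction k) (auto simp: is_partition_def algebra_simps)
  show N: "N \<ge> 1" using assms by (cases "N = 0") (auto simp: is_partition_def)
  show pi: "\<pi> = T / real N" using lin[of N] N assms(1) by (auto simp: is_partition_def field_simps)
  show "u k = grid T N k" if "k \<le> N" using lin[OF that] by (simp add: grid_def pi)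
qed

lemma step_path_at_grid:
  assumes u: "\<And>k. k \<le> N \<Longrightarrow> u k = grid T N k" and T: "T > 0" and N: "N \<ge> 1" and t: "0 \<le> t" "t \<le> T"
  obtains s where "0 \<le> s" "s \<le> t" "t - s \<le> T / real N" "step_path T N u X t = X s"
proof (cases "t = T")
  case True
  have "indicator {u k..<u (Suc k)} t = (0::real)" if "k < N" for k
    using that grid_le[OF T, of "Suc k" N] u[of "Suc k"] True by (auto simp: indicator_def)
  then have "step_path T N u X t = X t" using True by (simp add: step_path_def)
  then show ?thesis using that[of t] t T by simp
next
  case False
  obtain k where k: "k < N" "grid T N k \<le> t" "t < grid T N (Suc k)"
    using grid_cell[OF T N t] False t by (metis order.not_eq_order_implies_strict)
  have "(\<Sum>j<N. indicator {u j..<u (Suc j)} t *\<^sub>R X (u j)) = (\<Sum>j<N. if j = k then X (u k) else 0)"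
  proof (intro sum.cong refl)
    fix j assume "j \<in> {..<N}"
    then have j: "u j = grid T N j" "u (Suc j) = grid T N (Suc j)" using u by auto
    have "t \<notin> {u j..<u (Suc j)}" if "j \<noteq> k"
    proof -
      from that consider "Suc j \<le> k" | "Suc k \<le> j" by linarith
      then show ?thesis
        using k grid_mono[OF T, of "Suc j" k N] grid_mono[OF T, of "Suc k" j N] by cases (auto simp: j)
    qed
    then show "indicator {u j..<u (Suc j)} t *\<^sub>R X (u j) = (if j = k then X (u k) else 0)"
      using k u[of k] by (auto simp: j)
  qed
  then have "step_path T N u X t = X (grid T N k)"
    using k False u[of k] by (simp add: step_path_def)
  then show ?thesis using that[of "grid T N k"] k grid_nonneg[OF T, of N k] grid_Suc[of T N k] by simp
qed

text \<open>Since the two levels of the path are Hoelder continuous of exponents above \<open>1 / p\<close> and equal to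
  \<open>2 / p\<close>, their powers \<open>p\<close> and \<open>p / 2\<close> are bounded by multiples of \<open>t - s\<close>.  The constants are doubled
  so that each of the two suprema is at most \<open>1 / 2\<close>.\<close>

lemma property_RIE_of_components:
  fixes X :: "real \<Rightarrow> real ^ 'd"
  assumes T: "T > 0" and p: "2 < p" "p < 3"
    and part: "\<And>n. is_partition T (N n) (u n)"
    and equi: "\<And>n i. i < N n \<Longrightarrow> u n (Suc i) - u n i = \<pi> n" and \<pi>: "\<pi> \<longlonglongrightarrow> 0"
    and \<eta>: "\<eta> > 0" and \<alpha>: "2 * \<alpha> = 2 / p + \<eta>"
    and X: "\<And>i. holder_on T \<alpha> (\<lambda>t. X t $ i)"
    and R: "\<And>i j. refinement_bound T \<eta> (2 / p) (\<lambda>t. X t $ i) (\<lambda>t. X t $ j)"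
  shows "property_RIE T p N u X"
proof -
  have N: "N n \<ge> 1" and \<pi>_eq: "\<pi> n = T / real (N n)" and u: "k \<le> N n \<Longrightarrow> u n k = grid T (N n) k" for n k
    using equidistant_partition_grid[OF part T equi] by auto
  have mesh: "mesh (N n) (u n) = \<pi> n" for n
  proof -
    have "(\<lambda>i. \<bar>u n (Suc i) - u n i\<bar>) ` {..<N n} = {\<bar>\<pi> n\<bar>}"
      using equi[of _ n] N[of n] by (auto simp: image_iff intro!: exI[of _ 0])
    then show ?thesis using T by (simp add: mesh_def \<pi>_eq)
  qed
  have pair: "compensated_pair T \<alpha> (2 / p) \<eta> (\<lambda>t. X t $ i) (\<lambda>t. X t $ j)" for i j
  proof
    have "0 < 2 * \<alpha>" unfolding \<alpha> using p \<eta> by (intro add_pos_pos divide_pos_pos) auto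
    then show "0 < \<alpha>" by simp
  qed (use T p \<eta> \<alpha> X R in auto)
  have \<alpha>0: "\<alpha> > 0" using pair by (rule compensated_pair.pos)
  have cont_i: "continuous_on {0..T} (\<lambda>t. X t $ i)" for i
    using X \<alpha>0 by (rule holder_on_continuous)
  have cont: "continuous_on {0..T} X"
    using continuous_on_vec_lambda[of "{0..T}" "\<lambda>i t. X t $ i"] cont_i by simp
  have cadlag: "cadlag_on T X"
    unfolding cadlag_on_def
  proof (intro conjI ballI)
    fix t assume t: "t \<in> {0..<T}"
    then have "(X \<longlongrightarrow> X t) (at t within {0..T})" using cont by (auto simp: continuous_on_def)
    then have "(X \<longlongrightarrow> X t) (at t within {t..T})"
      by (rule tendsto_within_subset) (use t in auto)
    then show "(X \<longlongrightarrow> X t) (at_right t)"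
      using t by (simp add: at_within_Icc_at_right)
  next
    fix t assume t: "t \<in> {0<..T}"
    then have "(X \<longlongrightarrow> X t) (at t within {0..T})" using cont by (auto simp: continuous_on_def)
    then have "(X \<longlongrightarrow> X t) (at t within {0..t})"
      by (rule tendsto_within_subset) (use t in auto)
    then show "\<exists>l. (X \<longlongrightarrow> l) (at_left t)"
      using t by (auto simp: at_within_Icc_at_left)
  qed
  have "\<exists>C\<ge>0. \<forall>s t. 0 \<le> s \<longrightarrow> s \<le> t \<longrightarrow> t \<le> T \<longrightarrow> \<bar>X t $ i - X s $ i\<bar> \<le> C * (t - s) powr \<alpha>" for i
    using X[of i] by (simp add: holder_on_def)
  then obtain C where C: "\<And>i. C i \<ge> 0"
    "\<And>i s t. 0 \<le> s \<Longrightarrow> s \<le> t \<Longrightarrow> t \<le> T \<Longrightarrow> \<bar>X t $ i - X s $ i\<bar> \<le> C i * (t - s) powr \<alpha>"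
    by metis
  define C' where "C' = sum C UNIV"
  have C'0: "C' \<ge> 0" using C(1) by (auto simp: C'_def intro: sum_nonneg)
  have CX: "norm (X t - X s) \<le> C' * (t - s) powr \<alpha>" if "0 \<le> s" "s \<le> t" "t \<le> T" for s t
    unfolding C'_def sum_distrib_right by (rule norm_vec_le_sum) (use C(2)[OF that] in simp)
  have rate: "(\<lambda>n. c * \<pi> n powr x) \<longlonglongrightarrow> 0" if "x > 0" for c x
    using that T by (intro tendsto_mult_right_zero tendsto_zero_powrI[OF \<pi> tendsto_const])
      (auto simp: \<pi>_eq)
  have step: "uniform_limit {0..T} (\<lambda>n. step_path T (N n) (u n) X) X sequentially"
  proof (rule uniform_limit_of_bound[OF _ rate[OF \<alpha>0]])
    fix n t assume t: "t \<in> {0..T}"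
    then obtain s where s: "0 \<le> s" "s \<le> t" "t - s \<le> \<pi> n" "step_path T (N n) (u n) X t = X s"
      using step_path_at_grid[where N = "N n" and u = "u n" and T = T and t = t and X = X] u T N[of n]
      unfolding \<pi>_eq by auto
    have "norm (step_path T (N n) (u n) X t - X t) \<le> C' * (t - s) powr \<alpha>"
      using CX[of s t] s t by (simp add: norm_minus_commute)
    also have "\<dots> \<le> C' * \<pi> n powr \<alpha>"
      using s C'0 \<alpha>0 by (intro mult_left_mono powr_mono2) auto
    finally show "norm (step_path T (N n) (u n) X t - X t) \<le> C' * \<pi> n powr \<alpha>" .
  qed
  have rs: "riemann_sum (N n) (u n) X t $ i $ j = grid_sum T (N n) (\<lambda>t. X t $ i) (\<lambda>t. X t $ j) t" for n t i j
    unfolding riemann_sum_def grid_sum_def outer_def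
    by (auto simp: sum_component u intro!: sum.cong)
  have "\<exists>J K. K \<ge> 0 \<and> (\<forall>N\<ge>1. \<forall>t. 0 \<le> t \<longrightarrow> t \<le> T \<longrightarrow>
     \<bar>grid_sum T N (\<lambda>t. X t $ i) (\<lambda>t. X t $ j) t - J t\<bar> \<le> K * (T / real N) powr \<eta>)" for i j
    using compensated_pair.grid_sum_uniform_error[OF pair[of i j]] by metis
  then obtain J K where K: "\<And>i j. K i j \<ge> 0" "\<And>i j N t. N \<ge> 1 \<Longrightarrow> 0 \<le> t \<Longrightarrow> t \<le> T \<Longrightarrow>
     \<bar>grid_sum T N (\<lambda>t. X t $ i) (\<lambda>t. X t $ j) t - J i j t\<bar> \<le> K i j * (T / real N) powr \<eta>"
    by metis
  have "uniform_limit {0..T} (\<lambda>n. riemann_sum (N n) (u n) X) (\<lambda>t. \<chi> i j. J i j t) sequentially"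
  proof (rule uniform_limit_of_bound[OF _ rate[OF \<eta>]])
    fix n t assume "t \<in> {0..T}"
    then show "norm (riemann_sum (N n) (u n) X t - (\<chi> i j. J i j t)) \<le> (\<Sum>i\<in>UNIV. \<Sum>j\<in>UNIV. K i j) * \<pi> n powr \<eta>"
      unfolding sum_distrib_right \<pi>_eq by (intro norm_matrix_le_sum) (auto simp: rs intro!: K(2) N)
  qed
  then have riemann: "uniformly_convergent_on {0..T} (\<lambda>n. riemann_sum (N n) (u n) X)"
    by (auto simp: uniformly_convergent_on_def)
  have "\<exists>K\<ge>0. \<forall>N k l. k < l \<longrightarrow> l \<le> N \<longrightarrow>
     \<bar>grid_sum T N (\<lambda>t. X t $ i) (\<lambda>t. X t $ j) (grid T N l) - grid_sum T N (\<lambda>t. X t $ i) (\<lambda>t. X t $ j) (grid T N k)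
       - X (grid T N k) $ i * (X (grid T N l) $ j - X (grid T N k) $ j)\<bar> \<le> K * (grid T N l - grid T N k) powr (2 / p)" for i j
    using compensated_pair.grid_area_bound[OF pair[of i j]] by metis
  then obtain A where A: "\<And>i j. A i j \<ge> 0" "\<And>i j N k l. k < l \<Longrightarrow> l \<le> N \<Longrightarrow>
     \<bar>grid_sum T N (\<lambda>t. X t $ i) (\<lambda>t. X t $ j) (grid T N l) - grid_sum T N (\<lambda>t. X t $ i) (\<lambda>t. X t $ j) (grid T N k)
       - X (grid T N k) $ i * (X (grid T N l) $ j - X (grid T N k) $ j)\<bar> \<le> A i j * (grid T N l - grid T N k) powr (2 / p)"
    by metis
  define A' where "A' = (\<Sum>i\<in>UNIV. \<Sum>j\<in>UNIV. A i j)"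
  have A'0: "A' \<ge> 0" using A(1) by (auto simp: A'_def intro!: sum_nonneg)
  \<comment> \<open>one linear control serves both levels\<close>
  define c where "c = 2 * (C' powr p * T powr (\<alpha> * p - 1) + A' powr (p / 2))"
  have c0: "c \<ge> 0" by (simp add: c_def)
  define w where "w = (\<lambda>s t::real. c * (t - s))"
  have control: "control_function T w"
    using c0 by (auto simp: control_function_def time_simplex_def w_def algebra_simps intro: mult_right_mono)
  have first: "(SUP (s, t)\<in>time_simplex T. ennreal (norm (X t - X s) powr p) / ennreal (w s t)) \<le> ennreal (1/2)"
  proof (rule SUP_least, clarify)
    fix s t assume "(s, t) \<in> time_simplex T"
    then have st: "0 \<le> s" "s \<le> t" "t \<le> T" by (auto simp: time_simplex_def)
    have "norm (X t - X s) powr p \<le> (C' * (t - s) powr \<alpha>) powr p"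
      using CX[OF st] p by (intro powr_mono2) auto
    also have "\<dots> = C' powr p * (t - s) powr (\<alpha> * p)" by (simp add: powr_mult powr_powr)
    also have "(t - s) powr (\<alpha> * p) = (t - s) powr (\<alpha> * p - 1) * (t - s)"
      using st powr_add[of "t - s" "\<alpha> * p - 1" 1] by simp
    also have "C' powr p * ((t - s) powr (\<alpha> * p - 1) * (t - s)) \<le> C' powr p * (T powr (\<alpha> * p - 1) * (t - s))"
    proof (intro mult_left_mono mult_right_mono powr_mono2)
      have "(2 * \<alpha>) * p = 2 + \<eta> * p" unfolding \<alpha> using p by (simp add: field_simps)
      then show "0 \<le> \<alpha> * p - 1" using \<eta> p mult_pos_pos[of \<eta> p] by linarith
    qed (use st in auto)
    also have "\<dots> \<le> (1/2) * w s t"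
      using st by (simp add: w_def c_def algebra_simps mult_right_mono)
    finally show "ennreal (norm (X t - X s) powr p) / ennreal (w s t) \<le> ennreal (1/2)"
      using st c0 by (intro ennreal_quotient_le) (auto simp: w_def)
  qed
  have second: "(SUP n. SUP (k, l)\<in>{(k, l). k < l \<and> l \<le> N n}.
           ennreal (norm (riemann_sum (N n) (u n) X (u n l) - riemann_sum (N n) (u n) X (u n k)
                          - outer (X (u n k)) (X (u n l) - X (u n k))) powr (p / 2))
           / ennreal (w (u n k) (u n l))) \<le> ennreal (1/2)"
  proof (intro SUP_least, clarify)
    fix n k l assume kl: "k < l" "l \<le> N n"
    let ?A = "riemann_sum (N n) (u n) X (u n l) - riemann_sum (N n) (u n) X (u n k)
                          - outer (X (u n k)) (X (u n l) - X (u n k))"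
    have ukl: "u n k = grid T (N n) k" "u n l = grid T (N n) l" using kl u by auto
    let ?L = "u n l - u n k"
    have L: "0 \<le> ?L" using kl T by (auto simp: ukl intro: grid_mono)
    have "norm ?A \<le> A' * ?L powr (2 / p)"
      unfolding A'_def sum_distrib_right
      by (intro norm_matrix_le_sum) (use A(2)[OF kl] in \<open>simp add: rs outer_def ukl\<close>)
    then have "norm ?A powr (p / 2) \<le> (A' * ?L powr (2 / p)) powr (p / 2)"
      using p by (intro powr_mono2) auto
    also have "\<dots> = A' powr (p / 2) * ?L"
      using p L by (simp add: powr_mult powr_powr)
    also have "\<dots> \<le> (c / 2) * ?L"
      using L by (intro mult_right_mono) (simp_all add: c_def)
    also have "\<dots> = (1/2) * w (u n k) (u n l)" by (simp add: w_def)
    finally show "ennreal (norm ?A powr (p / 2)) / ennreal (w (u n k) (u n l)) \<le> ennreal (1/2)"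
      using L c0 by (intro ennreal_quotient_le) (auto simp: w_def)
  qed
  have "ennreal (1/2) + ennreal (1/2) = ennreal (1/2 + 1/2)"
    by (rule ennreal_plus[symmetric]) auto
  then have half: "ennreal (1/2) + ennreal (1/2) = 1" by simp
  have mesh0: "(\<lambda>n. mesh (N n) (u n)) \<longlonglongrightarrow> 0" using \<pi> by (simp add: mesh)
  note bound = add_mono[OF first second, unfolded half]
  show ?thesis
    unfolding property_RIE_def
    by (intro conjI allI exI[of _ w] p part mesh0 cadlag step riemann control bound)
qed

section \<open>Brownian and fractional Brownian motion jointly\<close>

text \<open>The logarithm is eventually at least 1, so the power of the mesh tends to 0 by itself.\<close>

lemma mesh_tendsto_zero:
  fixes \<pi> :: "nat \<Rightarrow> real"
  assumes "\<And>n. \<pi> n > 0" "(\<lambda>n. \<pi> n powr r * ln (real n)) \<longlonglongrightarrow> 0" "r > 0"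
  shows "\<pi> \<longlonglongrightarrow> 0"
proof -
  have "\<forall>\<^sub>F n in sequentially. 1 \<le> ln (real n)"
    by (rule eventually_compose_filterlim[OF eventually_ge_at_top[of 1] filterlim_compose[OF ln_at_top filterlim_real_sequentially]])
  then have "\<forall>\<^sub>F n in sequentially. norm (\<pi> n powr r) \<le> \<pi> n powr r * ln (real n)"
    by eventually_elim (use assms(1) in \<open>simp add: mult_le_cancel_left1\<close>)
  then have "(\<lambda>n. \<pi> n powr r) \<longlonglongrightarrow> 0"
    using assms(2) by (rule Lim_null_comparison)
  then have "(\<lambda>n. (\<pi> n powr r) powr (1 / r)) \<longlonglongrightarrow> 0"
    by (rule tendsto_zero_powrI[OF _ tendsto_const]) (use assms(3) in simp_all)
  then show ?thesis using assms(1,3) by (simp add: powr_powr less_imp_le)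
qed

theorem lemma4p1:
  fixes M :: "'a measure" and F :: "real \<Rightarrow> 'a measure"
    and W :: "real \<Rightarrow> 'a \<Rightarrow> real ^ 'd1"
    and WH :: "real \<Rightarrow> 'a \<Rightarrow> real ^ 'd2"
    and T H p :: real
    and N :: "nat \<Rightarrow> nat" and u :: "nat \<Rightarrow> nat \<Rightarrow> real" and \<pi> :: "nat \<Rightarrow> real"
  assumes "T > 0"
    and "usual_filtered_prob_space M F T"
    and "prob_space.brownian_motion M T W"
    and "1 / 2 < H" and "H < 1"
    and "prob_space.fractional_brownian_motion M T H WH"
    and "prob_space.indep_processes M T W WH"
    and "2 < p" and "p < 3" and "1 / p + H > 1"
    and "\<And>n. is_partition T (N n) (u n)"
    and "\<And>n. \<pi> n > 0"
    and "\<And>n i. i < N n \<Longrightarrow> u n (Suc i) - u n i = \<pi> n"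
    and "(\<lambda>n. \<pi> n powr (2 - 4 / p) * ln (real n)) \<longlonglongrightarrow> 0"
  shows "AE \<omega> in M. property_RIE T p N u (\<lambda>t. join_vec (W t \<omega>) (WH t \<omega>))"
proof -
  interpret usual_filtered_prob_space M F T by fact
  note T = \<open>T > 0\<close> and p = \<open>2 < p\<close> \<open>p < 3\<close> and W = assms(3) and WH = assms(6)
  \<comment> \<open>With \<open>\<kappa> = 1 - 2 / p\<close> all exponents become linear in \<open>\<kappa>\<close>: \<open>W\<close> is Hoelder continuous of exponent
    \<open>a < 1 / 2\<close> and \<open>WH\<close> of exponent \<open>b = 1 - 1 / p < H\<close>, where \<open>a\<close> is large enough for Young's case
    \<open>a + b = 1 + \<kappa> / 4\<close>, and \<open>\<eta>\<close> is small enough for \<open>\<eta> + 2 / p < 1\<close> and \<open>\<alpha> \<le> a\<close>.\<close>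
  define \<kappa> where "\<kappa> = 1 - 2 / p"
  have \<kappa>: "0 < \<kappa>" "\<kappa> < 1/3" using p by (auto simp: \<kappa>_def field_simps)
  have pk: "2 / p = 1 - \<kappa>" "1 / p = (1 - \<kappa>) / 2" by (simp_all add: \<kappa>_def)
  define \<eta> where "\<eta> = \<kappa> / 4"
  define a where "a = 1/2 - \<kappa> / 4"
  define b where "b = 1/2 + \<kappa> / 2"
  define \<alpha> where "\<alpha> = 1/2 - 3 * \<kappa> / 8"
  have b: "b < H" using \<open>1 / p + H > 1\<close> by (simp add: b_def pk field_simps)
  have \<pi>: "\<pi> \<longlonglongrightarrow> 0"
    using assms(12,14) by (rule mesh_tendsto_zero) (use p in \<open>simp add: field_simps\<close>)
  have holdW: "AE \<omega> in M. \<forall>i. holder_on T a (\<lambda>t. W t \<omega> $ i)"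
    using \<kappa> by (simp add: AE_all_countable) (auto intro!: brownian_motion_holder[OF W T] simp: a_def)
  have areaW: "AE \<omega> in M. \<forall>i j. refinement_bound T \<eta> (2 / p) (\<lambda>t. W t \<omega> $ i) (\<lambda>t. W t \<omega> $ j)"
    using \<kappa> by (simp add: AE_all_countable)
      (auto intro!: brownian_refinement_bound[OF W T] simp: \<eta>_def pk)
  have holdH: "AE \<omega> in M. \<forall>i. holder_on T b (\<lambda>t. WH t \<omega> $ i)"
    using \<kappa> b by (simp add: AE_all_countable) (auto intro!: fractional_brownian_motion_holder[OF WH T] simp: b_def)
  from holdW areaW holdH show ?thesis
  proof eventually_elim
    case (elim \<omega>)
    let ?X = "\<lambda>t. join_vec (W t \<omega>) (WH t \<omega>)"
    have left: "(\<lambda>t. ?X t $ Inl i) = (\<lambda>t. W t \<omega> $ i)" for i by (simp add: join_vec_def)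
    have right: "(\<lambda>t. ?X t $ Inr i) = (\<lambda>t. WH t \<omega> $ i)" for i by (simp add: join_vec_def)
    have exps: "0 < a" "0 < b" "a + b \<ge> 1 + \<eta>" "b + b \<ge> 1 + \<eta>" "0 \<le> 2 / p" "2 / p \<le> 1" "\<eta> > 0"
      "\<alpha> \<le> a" "\<alpha> \<le> b"
      using \<kappa> by (auto simp: a_def b_def \<eta>_def \<alpha>_def pk)
    have hold: "holder_on T \<alpha> (\<lambda>t. ?X t $ i)" for i
      using elim exps by (cases i) (auto simp: left right intro: holder_on_weaken)
    have area: "refinement_bound T \<eta> (2 / p) (\<lambda>t. ?X t $ i) (\<lambda>t. ?X t $ j)" for i j
    proof (cases i; cases j)
      fix i' j' assume "i = Inl i'" "j = Inl j'"
      then show ?thesis using elim by (simp add: left)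
    next
      fix i' j' assume "i = Inl i'" "j = Inr j'"
      then show ?thesis using elim exps
        by (auto simp: left right intro!: refinement_bound_young[OF T, where a = a and b = b])
    next
      fix i' j' assume "i = Inr i'" "j = Inl j'"
      then show ?thesis using elim exps
        by (auto simp: left right intro!: refinement_bound_young[OF T, where a = b and b = a])
    next
      fix i' j' assume "i = Inr i'" "j = Inr j'"
      then show ?thesis using elim exps
        by (auto simp: left right intro!: refinement_bound_young[OF T, where a = b and b = b])
    qed
    show ?case
      by (rule property_RIE_of_components[OF T p assms(11,13) \<pi> exps(7) _ hold area])
        (auto simp: \<alpha>_def \<eta>_def pk)
  qed
qed

end
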